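(* Let $\sigma > \frac12$ be fixed. Then $|\psi_\sigma(x)| \le 1$ for all $x \in \mathbb{R}$. Moreover, there exist a constant $c \ge 0.47$ and $x_0(\sigma)$ such that \[ |\psi_\sigma(x)|\le \exp\left(-\,\frac{c\,x^{1/\sigma}}{\log (x^{1/\sigma})}\right) \quad\text{for all real } x \ge x_0(\sigma). \]
   Context: Let $(z_p)_{p}$, $p$ ranging over the primes, be independent random variables each uniformly distributed on the unit circle. For $\sigma>\frac12$ let $S:=-\sum_{p}\log(1-p^{-\sigma}z_p)$ (principal logarithm; the series converges almost surely), so $\Im S=-\sum_p\arg(1-p^{-\sigma}z_p)$ with principal argument. Let $\psi_\sigma(x):=\mathbb{E}[\exp(ix\,\Im S)]$, $x\in\mathbb{R}$, be the characteristic function of $\Im S$. *)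

theory Defs
  imports "HOL-Probability.Probability" "HOL-Computational_Algebra.Primes"
begin

definition uniform_circle :: "complex measure" where
  "uniform_circle = distr (uniform_measure lborel {0..2 * pi}) borel cis"

text \<open>
  For \<open>\<sigma> \<le> 1\<close> the series converges almost surely but in general not absolutely, so it is
  summed in increasing order of the primes; on the null set where it diverges, the value of the
  sum is a fixed unspecified number.
\<close>

definition log_euler_product :: "real \<Rightarrow> (nat \<Rightarrow> 'a \<Rightarrow> complex) \<Rightarrow> 'a \<Rightarrow> complex" where
  "log_euler_product \<sigma> z \<omega> =
     - (\<Sum>p. if prime p then Ln (1 - of_real (real p powr - \<sigma>) * z p \<omega>) else 0)"

definition psi :: "'a measure \<Rightarrow> (nat \<Rightarrow> 'a \<Rightarrow> complex) \<Rightarrow> real \<Rightarrow> real \<Rightarrow> complex" where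
  "psi M z \<sigma> x = (CLINT \<omega>|M. exp (\<i> * of_real x * of_real (Im (log_euler_product \<sigma> z \<omega>))))"

lemma borel_measurable_Ln: "Ln \<in> borel_measurable borel"
proof -
  define g where "g = (\<lambda>z. if z \<in> - \<real>\<^sub>\<le>\<^sub>0 then Ln z else 0)"
  have A [measurable]: "- \<real>\<^sub>\<le>\<^sub>0 \<in> sets (borel :: complex measure)"
    by (intro borel_open) (simp add: open_Compl)
  have [measurable]: "g \<in> borel_measurable borel"
    unfolding g_def
    by (rule borel_measurable_continuous_on_if[OF A]) (auto intro!: continuous_intros)
  have "Ln z = (if z \<in> - \<real>\<^sub>\<le>\<^sub>0 then g z else if z = 0 then Ln 0 else g (- z) + \<i> * of_real pi)"
    for z
  proof -
    have "Ln z = Ln (- z) + \<i> * of_real pi" "- z \<notin> \<real>\<^sub>\<le>\<^sub>0" if "z \<in> \<real>\<^sub>\<le>\<^sub>0" "z \<noteq> 0"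
    proof -
      from that have z: "Re z < 0" "Im z = 0"
        by (auto simp: complex_nonpos_Reals_iff complex_eq_iff)
      then show "- z \<notin> \<real>\<^sub>\<le>\<^sub>0"
        by (simp add: complex_nonpos_Reals_iff)
      from Ln_minus[of "- z"] that z show "Ln z = Ln (- z) + \<i> * of_real pi"
        by simp
    qed
    then show ?thesis
      by (auto simp: g_def)
  qed
  then have "Ln = (\<lambda>z. if z \<in> - \<real>\<^sub>\<le>\<^sub>0 then g z else if z = 0 then Ln 0 else g (- z) + \<i> * of_real pi)"
    by (intro ext)
  then show ?thesis
    by (rule ssubst) measurable
qed

lemma log_euler_product_measurable:
  assumes "\<And>p. prime p \<Longrightarrow> z p \<in> borel_measurable M"
  shows "log_euler_product \<sigma> z \<in> borel_measurable M"
proof -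
  have "(\<lambda>\<omega>. if prime p then Ln (1 - of_real (real p powr - \<sigma>) * z p \<omega>) else 0)
          \<in> borel_measurable M" for p
  proof (cases "prime p")
    case True
    then have [measurable]: "z p \<in> borel_measurable M"
      by (rule assms)
    note [measurable] = borel_measurable_Ln
    show ?thesis
      by (simp only: True if_True) measurable
  qed simp
  then show ?thesis
    unfolding log_euler_product_def
    by (intro borel_measurable_uminus borel_measurable_suminf)
qed

lemma psi_eq_char:
  assumes "\<And>p. prime p \<Longrightarrow> z p \<in> borel_measurable M"
  shows "psi M z \<sigma> x = char (distr M borel (\<lambda>\<omega>. Im (log_euler_product \<sigma> z \<omega>))) x"
proof -
  note [measurable] = log_euler_product_measurable[of z M \<sigma>, OF assms]
  show ?thesis
    unfolding psi_def char_def
    by (subst integral_distr) (auto simp: mult.assoc)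
qed

end

theory Submission
  imports Defs "HOL-Real_Asymp.Real_Asymp"
begin

text \<open>
  By independence \<open>\<psi>(x)\<close> is the product over the primes of the local characteristic functions, so it
  is bounded by any finite partial product. Expanding both factors of
  \<open>(1 - r z) powr (-x/2) * cnj ((1 - r z) powr (x/2))\<close> binomially and integrating over the circle, the
  local factor at \<open>p\<close> is the hypergeometric value \<open>F(x/2, -x/2; 1; r\<^sup>2)\<close> with \<open>r = p powr -\<sigma>\<close>, a
  perturbation of the Bessel function \<open>J\<^sub>0(x r)\<close>. With \<open>w = (x r)\<^sup>2/4\<close> its modulus is at most
  \<open>exp (- min w (ln 2))\<close> once \<open>x\<close> is large: for \<open>w \<le> 2\<close> by the leading terms of the series, and for
  \<open>w \<ge> 2\<close> because a Sonin function, monotone by the hypergeometric equation, is at most \<open>1/4\<close> at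
  \<open>w = 2\<close>.

  With \<open>b = 1/(2\<sigma>)\<close> and \<open>y = x powr (1/\<sigma>)\<close> we have \<open>w \<ge> v\<close> iff \<open>p \<le> y (4v) powr -b\<close>. Hence the sum of
  \<open>min w (ln 2)\<close> over the primes is the integral of \<open>\<pi>(y (4v) powr -b)\<close> over \<open>0 \<le> v \<le> ln 2\<close>, and the
  elementary bound \<open>\<pi>(t) \<ge> (ln 2 - \<epsilon>) t / ln t\<close> gives the constant
  \<open>ln 2 * (4 ln 2) powr (1-b) / (4 (1-b)) \<ge> ln 2 * e * ln (4 ln 2) / 4 > 0.47\<close>, uniformly in \<open>b\<close>.
\<close>

section \<open>A lower bound of Chebyshev type for the number of primes\<close>

text \<open>
  Induction on \<open>m\<close> along Leibniz's harmonic triangle: the numbers \<open>1 / (m * (n choose m))\<close> are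
  successive differences of unit fractions.
\<close>

lemma binomial_dvd_Lcm:
  assumes "1 \<le> m" "m \<le> n"
  shows "m * (n choose m) dvd (Lcm {1..n} :: nat)"
proof -
  have "real (Lcm {1..n}) / real (m * (n choose m)) \<in> \<int>"
    using assms
  proof (induction m arbitrary: n rule: nat_induct_at_least)
    case base
    then have "n dvd Lcm {1..n}"
      by (intro dvd_Lcm) auto
    then show ?case
      by (auto elim!: dvdE)
  next
    case (Suc m)
    then obtain k where n: "n = Suc k" and mk: "m \<le> k"
      by (cases n) auto
    let ?C = "real (n choose m)"
    have C: "?C > 0" "real m > 0"
      using mk n Suc by auto
    have "Suc m * (Suc k choose Suc m) = (Suc k - m) * (Suc k choose m)"
      using mk binomial_absorb_comp[of "Suc k" m]
      by (metis binomial_absorption diff_Suc_1 mult.commute)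
    then have e1: "real (Suc m * (n choose Suc m)) = (real n - real m) * ?C"
      using mk by (metis le_SucI n of_nat_diff of_nat_mult)
    have "(Suc k - m) * (Suc k choose m) = Suc k * (k choose m)"
      using mk binomial_absorb_comp[of "Suc k" m] by simp
    then have e2: "real n * real (k choose m) = (real n - real m) * ?C"
      using mk by (metis le_SucI n of_nat_diff of_nat_mult)
    have nm: "real n - real m > 0" "real n > 0"
      using mk n by auto
    have e3: "real (k choose m) = (real n - real m) * ?C / real n"
      using e2 nm by (simp add: field_simps)
    have eq: "1 / real (Suc m * (n choose Suc m))
        = 1 / real (m * (k choose m)) - 1 / real (m * (n choose m))"
      unfolding e1 of_nat_mult[of m] e3 using C nm by (simp add: divide_simps)
    have sub: "Lcm {1..k} dvd Lcm {1..n}"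
      unfolding n by (rule Lcm_subset) auto
    then obtain d where d: "Lcm {1..n} = Lcm {1..k} * d"
      by (elim dvdE)
    have "real (Lcm {1..n}) / real (m * (k choose m)) \<in> \<int>"
      using Suc.IH[of k] mk unfolding d of_nat_mult
      by (metis Ints_mult Ints_of_nat of_nat_mult times_divide_eq_left)
    moreover have "real (Lcm {1..n}) / real (m * (n choose m)) \<in> \<int>"
      using Suc.IH[of n] mk n by simp
    ultimately have "real (Lcm {1..n}) / real (m * (k choose m))
        - real (Lcm {1..n}) / real (m * (n choose m)) \<in> \<int>"
      by (rule Ints_diff)
    then have "real (Lcm {1..n}) * (1 / real (Suc m * (n choose Suc m))) \<in> \<int>"
      unfolding eq by (simp add: right_diff_distrib)
    then show ?case
      by simp
  qed
  then obtain i where "real (Lcm {1..n}) / real (m * (n choose m)) = of_int i"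
    by (elim Ints_cases)
  moreover have "m * (n choose m) > 0"
    using assms by simp
  ultimately have "real (Lcm {1..n}) = of_int i * real (m * (n choose m))"
    by (simp add: divide_eq_eq)
  then have "int (Lcm {1..n}) = i * int (m * (n choose m))"
    by (metis (mono_tags) of_int_eq_iff of_int_mult of_int_of_nat_eq)
  then show ?thesis
    by (metis dvd_triv_right int_dvd_int_iff)
qed

text \<open>For \<open>m >= 1\<close> the coefficient \<open>n choose m\<close> is at most
  \<open>m * (n choose m)\<close>, a divisor of the lcm. The \<open>n + 1\<close> coefficients of
  the row sum to \<open>2 ^ n\<close>.\<close>

lemma two_power_le_Lcm: "2 ^ n \<le> (n + 1) * Lcm {1..n}"
proof -
  have L: "Lcm {1..n} > (0::nat)"
    by (rule Nat.gr0I) (auto simp: Lcm_0_iff)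
  have *: "n choose m \<le> Lcm {1..n}" if "m \<in> {..n}" for m
  proof (cases "m = 0")
    case True
    with L show ?thesis by simp
  next
    case False
    then have "m * (n choose m) \<le> Lcm {1..n}"
      using that binomial_dvd_Lcm[of m n] L by (intro dvd_imp_le) auto
    moreover have "n choose m \<le> m * (n choose m)"
      using False by simp
    ultimately show ?thesis by linarith
  qed
  have "2 ^ n = (\<Sum>m\<le>n. n choose m)"
    by (simp add: choose_row_sum)
  also have "\<dots> \<le> (\<Sum>m\<le>n. Lcm {1..n})"
    by (intro sum_mono *)
  finally show ?thesis by simp
qed

text \<open>The multiplicity of a prime in an lcm is the maximum of its multiplicities in the
  members. The condition \<open>k > 0\<close> settles the empty set, whose \<open>Lcm\<close> is
  1.\<close>

lemma prime_power_dvd_Lcm: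
  fixes p :: nat
  assumes "finite A" "prime p" "0 \<notin> A" "k > 0" "p ^ k dvd Lcm A"
  shows "\<exists>a\<in>A. p ^ k dvd a"
  using assms(1,3,5)
proof (induction A rule: finite_induct)
  case empty
  with assms(2,4) show ?case
    by auto
next
  case (insert a A)
  have nz: "a \<noteq> 0" "Lcm A \<noteq> 0"
    using insert by (auto simp: Lcm_0_iff)
  have p: "\<not> is_unit p" "lcm a (Lcm A) \<noteq> 0"
    using assms(2) nz by (auto simp: lcm_eq_0_iff)
  have "k \<le> multiplicity p (lcm a (Lcm A))"
    using insert.prems p by (intro multiplicity_geI) auto
  also have "\<dots> = max (multiplicity p a) (multiplicity p (Lcm A))"
    using nz assms(2) by (intro multiplicity_lcm) auto
  finally have "p ^ k dvd a \<or> p ^ k dvd Lcm A"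
    by (auto simp: le_max_iff_disj intro: multiplicity_dvd')
  then show ?case
    using insert by auto
qed

text \<open>Each maximal prime power in the lcm already divides some number up to \<open>n\<close>,
  so every prime contributes a factor of at most \<open>n\<close>.\<close>

lemma Lcm_le_power_card_primes:
  fixes n :: nat
  assumes "n \<ge> 1"
  shows "Lcm {1..n} \<le> n ^ card {p. prime p \<and> p \<le> n}"
proof -
  let ?L = "Lcm {1..n}" and ?P = "{p. prime p \<and> p \<le> n}"
  have L: "?L \<noteq> 0"
    by (auto simp: Lcm_0_iff)
  have le: "p \<in> ?P \<and> p ^ multiplicity p ?L \<le> n" if "p \<in> prime_factors ?L" for p
  proof -
    from that have p: "prime p" "multiplicity p ?L > 0"
      by (auto simp: prime_factors_multiplicity)
    then have "\<exists>a\<in>{1..n}. p ^ multiplicity p ?L dvd a"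
      by (intro prime_power_dvd_Lcm) (auto simp: multiplicity_dvd)
    then have *: "p ^ multiplicity p ?L \<le> n"
      by (auto dest: dvd_imp_le)
    moreover have "p ^ 1 \<le> p ^ multiplicity p ?L"
      using p prime_gt_0_nat[of p] by (intro power_increasing) auto
    ultimately show ?thesis
      using p by auto
  qed
  have sub: "prime_factors ?L \<subseteq> ?P"
    using le by blast
  have fin: "finite ?P"
    by (rule finite_subset[of _ "{..n}"]) auto
  have "?L = (\<Prod>p\<in>prime_factors ?L. p ^ multiplicity p ?L)"
    using L by (simp add: prod_prime_factors)
  also have "\<dots> \<le> (\<Prod>p\<in>prime_factors ?L. n)"
    by (intro prod_mono conjI) (simp, use le in blast)
  also have "\<dots> = n ^ card (prime_factors ?L)"
    by simp
  also have "n ^ card (prime_factors ?L) \<le> n ^ card ?P"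
    using assms by (intro power_increasing card_mono sub fin)
  finally show ?thesis .
qed

lemma card_primes_ln_ge:
  fixes n :: nat
  assumes "n \<ge> 1"
  shows "real n * ln 2 - ln (real n + 1) \<le> real (card {p. prime p \<and> p \<le> n}) * ln (real n)"
proof -
  have "2 ^ n \<le> (n + 1) * n ^ card {p. prime p \<and> p \<le> n}"
    using two_power_le_Lcm[of n] Lcm_le_power_card_primes[OF assms]
    by (meson le_trans mult_le_mono2)
  then have "2 ^ n \<le> (real n + 1) * real n ^ card {p. prime p \<and> p \<le> n}"
    by (metis (mono_tags) of_nat_1 of_nat_add of_nat_le_iff of_nat_mult of_nat_numeral of_nat_power)
  then have "ln (2 ^ n) \<le> ln ((real n + 1) * real n ^ card {p. prime p \<and> p \<le> n})"
    using assms by (subst ln_le_cancel_iff) auto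
  then show ?thesis
    using assms by (simp add: ln_mult ln_realpow)
qed

text \<open>Rounding \<open>t\<close> down to an integer costs at most \<open>ln 2\<close>, and
  \<open>ln (t + 1)\<close> is of lower order; the gap between \<open>k\<close> and
  \<open>ln 2\<close> absorbs both.\<close>

lemma eventually_card_primes_ge:
  fixes k :: real
  assumes "k < ln 2"
  shows "\<forall>\<^sub>F t in at_top. k * t / ln t \<le> real (card {p. prime p \<and> real p \<le> t})"
proof -
  have "\<forall>\<^sub>F t in at_top. k * t \<le> (t - 1) * ln 2 - ln (t + 1)"
    using assms by real_asymp
  moreover have "\<forall>\<^sub>F t in at_top. t \<ge> (2::real)"
    by (rule eventually_ge_at_top)
  ultimately show ?thesis
  proof eventually_elim
    case (elim t)
    define n where "n = nat \<lfloor>t\<rfloor>"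
    have n: "real n \<le> t" "t - 1 \<le> real n" "n \<ge> 1" "real n \<ge> 2"
      using elim unfolding n_def by (auto simp: le_floor_iff le_nat_iff)
    have eq: "{p. prime p \<and> real p \<le> t} = {p. prime p \<and> p \<le> n}"
      using elim unfolding n_def by (auto simp: le_nat_iff le_floor_iff)
    have "k * t \<le> (t - 1) * ln 2 - ln (t + 1)"
      by (rule elim)
    also have "\<dots> \<le> real n * ln 2 - ln (real n + 1)"
      using n by (intro diff_mono mult_right_mono) auto
    also have "\<dots> \<le> real (card {p. prime p \<and> p \<le> n}) * ln (real n)"
      by (rule card_primes_ln_ge) (use n in auto)
    also have "\<dots> \<le> real (card {p. prime p \<and> p \<le> n}) * ln t"
      using n by (intro mult_left_mono) auto
    finally show ?case
      using elim eq by (simp add: divide_simps)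
  qed
qed

section \<open>A perturbed Bessel series\<close>

text \<open>
  For \<open>d = 4 / x\<^sup>2\<close> and \<open>w = x\<^sup>2 r\<^sup>2 / 4\<close> the series is \<open>F(x/2, -x/2; 1; r\<^sup>2)\<close>; for \<open>d = 0\<close> it is
  \<open>J\<^sub>0(2 sqrt w)\<close>. Its radius of convergence is \<open>1 / d\<close>.
\<close>

definition bessel_coeff :: "real \<Rightarrow> nat \<Rightarrow> real" where
  "bessel_coeff d n = (\<Prod>k<n. - (1 - d * real k ^ 2) / (real k + 1) ^ 2)"

definition bessel_like :: "real \<Rightarrow> real \<Rightarrow> real" where
  "bessel_like d w = (\<Sum>n. bessel_coeff d n * w ^ n)"

definition bessel_like' :: "real \<Rightarrow> real \<Rightarrow> real" where
  "bessel_like' d w = (\<Sum>n. diffs (bessel_coeff d) n * w ^ n)"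

lemma bessel_coeff_0: "bessel_coeff d 0 = 1"
  by (simp add: bessel_coeff_def)

lemma bessel_coeff_Suc:
  "bessel_coeff d (Suc n) = - (1 - d * real n ^ 2) / (real n + 1) ^ 2 * bessel_coeff d n"
  by (simp add: bessel_coeff_def)

text \<open>The numerator \<open>1 - d * n^2\<close> of the ratio lies between
  \<open>- d * n^2\<close> and 1. Two choices matter later: \<open>q = d\<close> for large
  \<open>n\<close> gives convergence for \<open>|w| < 1 / d\<close>, and
  \<open>q = 1 / (m + 1)^2\<close> gives explicit tail bounds.\<close>

lemma bessel_coeff_Suc_le:
  assumes "0 \<le> d" "d \<le> q" "1 / (real n + 1) ^ 2 \<le> q"
  shows "\<bar>bessel_coeff d (Suc n)\<bar> \<le> q * \<bar>bessel_coeff d n\<bar>"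
proof -
  have "1 \<le> q * (real n + 1) ^ 2"
    using assms(3) by (simp add: divide_simps)
  moreover have "d * real n ^ 2 \<le> q * (real n + 1) ^ 2"
    using assms by (intro mult_mono power_mono) auto
  moreover have "0 \<le> d * real n ^ 2"
    using assms by simp
  ultimately have "\<bar>1 - d * real n ^ 2\<bar> \<le> q * (real n + 1) ^ 2"
    by linarith
  then have "\<bar>- (1 - d * real n ^ 2) / (real n + 1) ^ 2\<bar> \<le> q"
    by (simp add: divide_simps)
  then show ?thesis
    unfolding bessel_coeff_Suc abs_mult by (intro mult_right_mono) auto
qed

lemma summable_bessel_coeff:
  assumes "0 < d" "\<bar>w\<bar> < 1 / d"
  shows "summable (\<lambda>n. bessel_coeff d n * w ^ n)"
proof (rule summable_ratio_test)
  show "d * \<bar>w\<bar> < 1"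
    using assms by (simp add: field_simps)
  fix n assume n: "nat \<lceil>1 / d\<rceil> \<le> n"
  have "1 / d \<le> real n + 1"
    using n by linarith
  also have "\<dots> \<le> (real n + 1) ^ 2"
    by (rule self_le_power) auto
  finally have "1 / (real n + 1) ^ 2 \<le> d"
    using assms by (simp add: divide_simps mult.commute)
  then have "\<bar>bessel_coeff d (Suc n)\<bar> \<le> d * \<bar>bessel_coeff d n\<bar>"
    using assms by (intro bessel_coeff_Suc_le) auto
  then have "\<bar>bessel_coeff d (Suc n)\<bar> * \<bar>w ^ Suc n\<bar> \<le> d * \<bar>bessel_coeff d n\<bar> * \<bar>w ^ Suc n\<bar>"
    by (rule mult_right_mono) auto
  then show "norm (bessel_coeff d (Suc n) * w ^ Suc n) \<le> d * \<bar>w\<bar> * norm (bessel_coeff d n * w ^ n)"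
    by (simp add: abs_mult mult_ac)
qed

lemma DERIV_bessel_like:
  assumes "0 < d" "\<bar>w\<bar> < 1 / d"
  shows "(bessel_like d has_field_derivative bessel_like' d w) (at w)"
  unfolding bessel_like_def [abs_def] bessel_like'_def
  using assms by (intro termdiffs_strong'[where K = "1 / d"] summable_bessel_coeff) auto

lemma summable_diffs_bessel_coeff:
  assumes "0 < d" "\<bar>w\<bar> < 1 / d"
  shows "summable (\<lambda>n. diffs (bessel_coeff d) n * w ^ n)"
  using assms by (intro termdiff_converges[where K = "1 / d"] summable_bessel_coeff) auto

text \<open>Let \<open>g\<close> be the derivative of \<open>w * f'(w)\<close>; its coefficients are
  \<open>(n + 1)^2 * c (n + 1)\<close>, and those of \<open>w * g\<close> are
  \<open>n^2 * c n\<close>. The recurrence for \<open>c\<close> thus reads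
  \<open>g = d * w * g - f\<close>, a form of the hypergeometric equation.\<close>

lemma bessel_like_ode:
  assumes "0 < d" "\<bar>w\<bar> < 1 / d"
  obtains f'' where "(bessel_like' d has_field_derivative f'') (at w)"
    and "(1 - d * w) * (w * f'' + bessel_like' d w) + bessel_like d w = 0"
proof
  let ?c = "bessel_coeff d"
  define f'' where "f'' = (\<Sum>n. diffs (diffs ?c) n * w ^ n)"
  show "(bessel_like' d has_field_derivative f'') (at w)"
    unfolding bessel_like'_def [abs_def] f''_def
    using assms by (intro termdiffs_strong'[where K = "1 / d"] summable_diffs_bessel_coeff) auto
  have "(\<lambda>n. diffs (diffs ?c) n * w ^ n) sums f''"
    unfolding f''_def using assms
    by (intro summable_sums termdiff_converges[where K = "1 / d"] summable_diffs_bessel_coeff) auto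
  then have "(\<lambda>n. w * (diffs (diffs ?c) n * w ^ n)) sums (w * f'')"
    by (rule sums_mult)
  then have "(\<lambda>n. real (Suc n) * (real (Suc n) + 1) * ?c (Suc (Suc n)) * w ^ Suc n) sums (w * f'')"
    by (rule sums_cong[THEN iffD1, rotated]) (simp add: diffs_def algebra_simps)
  \<comment> \<open>The term at \<open>n = 0\<close> vanishes, so the shift of index leaves the sum
    unchanged.\<close>
  then have s2: "(\<lambda>n. real n * (real n + 1) * ?c (Suc n) * w ^ n) sums (w * f'')"
    by (subst (asm) sums_Suc_iff) simp
  have s1: "(\<lambda>n. diffs ?c n * w ^ n) sums bessel_like' d w"
    unfolding bessel_like'_def using assms by (intro summable_sums summable_diffs_bessel_coeff)
  have s0: "(\<lambda>n. ?c n * w ^ n) sums bessel_like d w"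
    unfolding bessel_like_def using assms by (intro summable_sums summable_bessel_coeff)
  let ?e = "\<lambda>n. (real n + 1) ^ 2 * ?c (Suc n)"
  define g where "g = w * f'' + bessel_like' d w"
  have e: "(\<lambda>n. ?e n * w ^ n) sums g"
    unfolding g_def using sums_add[OF s2 s1]
    by (rule sums_cong[THEN iffD1, rotated]) (simp add: diffs_def algebra_simps power2_eq_square)
  then have "(\<lambda>n. real (Suc n) ^ 2 * ?c (Suc n) * w ^ Suc n) sums (w * g)"
    using sums_mult[OF e, of w] by (simp add: algebra_simps)
  then have "(\<lambda>n. real n ^ 2 * ?c n * w ^ n) sums (w * g)"
    by (subst (asm) sums_Suc_iff) simp
  from sums_diff[OF sums_mult[OF this, of d] s0]
  have "(\<lambda>n. d * (real n ^ 2 * ?c n * w ^ n) - ?c n * w ^ n) sums (d * (w * g) - bessel_like d w)" .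
  moreover have "d * (real n ^ 2 * ?c n * w ^ n) - ?c n * w ^ n = ?e n * w ^ n" for n
  proof -
    have "?e n = - (1 - d * real n ^ 2) * ?c n"
      by (simp add: bessel_coeff_Suc)
    then have "?e n * w ^ n = - (1 - d * real n ^ 2) * ?c n * w ^ n"
      by (simp only:)
    then show ?thesis
      by (simp add: algebra_simps)
  qed
  ultimately have "g = d * (w * g) - bessel_like d w"
    using e sums_unique2 by simp
  then show "(1 - d * w) * (w * f'' + bessel_like' d w) + bessel_like d w = 0"
    unfolding g_def by (simp add: algebra_simps)
qed

section \<open>The Sonin function and its monotonicity\<close>

text \<open>The weight \<open>(1 - d * w) * w\<close> is the coefficient of the second derivative in
  the differential equation, which makes the products \<open>f * f'\<close> cancel on
  differentiation. For \<open>d = 0\<close> the value is the sum of the squares of the Bessel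
  functions \<open>J_0\<close> and \<open>J_1\<close> at \<open>2 sqrt w\<close>.\<close>

definition sonin :: "real \<Rightarrow> real \<Rightarrow> real" where
  "sonin d w = bessel_like d w ^ 2 + (1 - d * w) * w * bessel_like' d w ^ 2"

text \<open>Differentiation gives \<open>2 * f'\<close> times the left side of the differential
  equation, minus \<open>f' ^ 2\<close>.\<close>

lemma DERIV_sonin:
  assumes "0 < d" "\<bar>w\<bar> < 1 / d"
  shows "(sonin d has_field_derivative - (bessel_like' d w ^ 2)) (at w)"
proof -
  obtain f'' where f'': "(bessel_like' d has_field_derivative f'') (at w)"
    and ode: "(1 - d * w) * (w * f'' + bessel_like' d w) + bessel_like d w = 0"
    using bessel_like_ode[OF assms] by blast
  let ?f = "bessel_like d w" and ?f' = "bessel_like' d w"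
  have "(sonin d has_field_derivative
          2 * ?f * ?f' + ((1 - 2 * d * w) * ?f' ^ 2 + 2 * (1 - d * w) * w * ?f' * f'')) (at w)"
    unfolding sonin_def [abs_def]
    by (rule derivative_eq_intros DERIV_bessel_like[OF assms] f'' refl)+
      (simp add: algebra_simps power2_eq_square)
  moreover have "2 * ?f * ?f' + ((1 - 2 * d * w) * ?f' ^ 2 + 2 * (1 - d * w) * w * ?f' * f'')
      = 2 * ?f' * ((1 - d * w) * (w * f'' + ?f') + ?f) - ?f' ^ 2"
    by (simp add: algebra_simps power2_eq_square)
  ultimately show ?thesis
    using ode by simp
qed

lemma sonin_antimono:
  assumes "0 < d" "0 \<le> v" "v \<le> w" "w < 1 / d"
  shows "sonin d w \<le> sonin d v"
proof (rule DERIV_nonpos_imp_nonincreasing[OF assms(3)])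
  fix y assume "v \<le> y" "y \<le> w"
  then show "\<exists>D. (sonin d has_field_derivative D) (at y) \<and> D \<le> 0"
    using assms by (intro exI[of _ "- (bessel_like' d y ^ 2)"] conjI DERIV_sonin) auto
qed

lemma bessel_like_sqr_le_sonin:
  assumes "0 < d" "0 \<le> w" "w < 1 / d"
  shows "bessel_like d w ^ 2 \<le> sonin d w"
proof -
  have "0 \<le> 1 - d * w"
    using assms by (simp add: field_simps)
  with assms show ?thesis
    by (simp add: sonin_def)
qed

section \<open>Numerical bounds from the leading terms of the series\<close>

lemma abs_suminf_le_geometric:
  fixes f :: "nat \<Rightarrow> real"
  assumes "\<And>n. \<bar>f n\<bar> \<le> c * q ^ n" "0 \<le> q" "q < 1"
  shows "\<bar>\<Sum>n. f n\<bar> \<le> c / (1 - q)"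
proof -
  have s: "(\<lambda>n. c * q ^ n) sums (c * (1 / (1 - q)))"
    using assms by (intro sums_mult geometric_sums) auto
  have "summable (\<lambda>n. \<bar>f n\<bar>)"
    by (rule summable_comparison_test[OF _ sums_summable[OF s]]) (use assms in auto)
  then have "\<bar>\<Sum>n. f n\<bar> \<le> (\<Sum>n. \<bar>f n\<bar>)"
    by (rule summable_rabs)
  also have "\<dots> \<le> (\<Sum>n. c * q ^ n)"
    using assms s \<open>summable (\<lambda>n. \<bar>f n\<bar>)\<close> by (intro suminf_le) (auto dest: sums_summable)
  also have "\<dots> = c / (1 - q)"
    using sums_unique[OF s] by simp
  finally show ?thesis .
qed

lemma bessel_coeff_values:
  "bessel_coeff d (Suc 0) = - 1"
  "bessel_coeff d 2 = (1 - d) / 4"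
  "bessel_coeff d 3 = - ((1 - d) * (1 - 4 * d) / 36)"
  "bessel_coeff d 4 = (1 - d) * (1 - 4 * d) * (1 - 9 * d) / 576"
  by (simp_all add: bessel_coeff_def eval_nat_numeral lessThan_Suc) (simp_all add: field_simps)

text \<open>The admissible ratios \<open>1 / (k + 1)^2\<close> decrease in \<open>k\<close>, so the
  one at \<open>k = m\<close> serves for all later indices as long as it also dominates
  \<open>d\<close>.\<close>

lemma bessel_coeff_geometric:
  assumes "0 \<le> d" "d \<le> 1 / (real m + 1) ^ 2"
  shows "\<bar>bessel_coeff d (n + m)\<bar> \<le> (1 / (real m + 1) ^ 2) ^ n * \<bar>bessel_coeff d m\<bar>"
proof (induction n)
  case (Suc n)
  have "\<bar>bessel_coeff d (Suc (n + m))\<bar> \<le> 1 / (real m + 1) ^ 2 * \<bar>bessel_coeff d (n + m)\<bar>"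
    using assms by (intro bessel_coeff_Suc_le divide_left_mono power_mono) auto
  also have "\<dots> \<le> 1 / (real m + 1) ^ 2 * ((1 / (real m + 1) ^ 2) ^ n * \<bar>bessel_coeff d m\<bar>)"
    by (intro mult_left_mono Suc.IH) auto
  finally show ?case
    by (simp add: mult_ac)
qed simp

lemma lessThan_4: "{..<4} = {0, 1, 2, 3::nat}"
  by auto

text \<open>\<open>B\<close> is the modulus of the cubic term. From there on successive terms shrink
  by at least \<open>w / 16 <= 1 / 8\<close>, so the tail is at most
  \<open>(B / 8) / (1 - 1 / 8) = B / 7\<close>.\<close>

lemma bessel_like_approx:
  assumes "0 < d" "d \<le> 1 / 1000" "0 \<le> w" "w \<le> 2"
  defines "B \<equiv> (1 - d) * (1 - 4 * d) / 36 * w ^ 3"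
  shows "\<bar>bessel_like d w - (1 - w + (1 - d) / 4 * w ^ 2 - B)\<bar> \<le> B / 7"
proof -
  have "2 < 1 / d"
    using assms by (simp add: field_simps)
  with assms have sm: "summable (\<lambda>n. bessel_coeff d n * w ^ n)"
    by (intro summable_bessel_coeff) auto
  have B: "\<bar>bessel_coeff d 3\<bar> * w ^ 3 = B"
    unfolding B_def using assms by (simp add: bessel_coeff_values abs_mult)
  have "bessel_like d w = (\<Sum>n. bessel_coeff d (n + 4) * w ^ (n + 4)) +
          (\<Sum>n<4. bessel_coeff d n * w ^ n)"
    unfolding bessel_like_def by (rule suminf_split_initial_segment[OF sm])
  also have "(\<Sum>n<4. bessel_coeff d n * w ^ n) = 1 - w + (1 - d) / 4 * w ^ 2 - B"
    by (simp add: B_def lessThan_4 bessel_coeff_0 bessel_coeff_values)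
  finally have eq: "bessel_like d w - (1 - w + (1 - d) / 4 * w ^ 2 - B)
      = (\<Sum>n. bessel_coeff d (n + 4) * w ^ (n + 4))" by simp
  have "\<bar>\<Sum>n. bessel_coeff d (n + 4) * w ^ (n + 4)\<bar> \<le> (B / 8) / (1 - 1 / 8)"
  proof (rule abs_suminf_le_geometric)
    fix n
    have "\<bar>bessel_coeff d (Suc n + 3)\<bar> \<le> (1 / (real 3 + 1) ^ 2) ^ Suc n * \<bar>bessel_coeff d 3\<bar>"
      using assms by (intro bessel_coeff_geometric) auto
    then have "\<bar>bessel_coeff d (n + 4) * w ^ (n + 4)\<bar> \<le> ((1 / 16) ^ Suc n * \<bar>bessel_coeff d 3\<bar>) * (w ^ 3 * w ^ Suc n)"
      using assms unfolding abs_mult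
      by (intro mult_mono) (auto simp: eval_nat_numeral)
    also have "\<dots> = B * (w / 16) ^ Suc n"
      by (simp add: B[symmetric] power_divide field_simps)
    also have "\<dots> \<le> B * (1 / 8) ^ Suc n"
      using assms unfolding B_def by (intro mult_left_mono power_mono) auto
    finally show "\<bar>bessel_coeff d (n + 4) * w ^ (n + 4)\<bar> \<le> B / 8 * (1 / 8) ^ n"
      by simp
  qed auto
  then show ?thesis
    unfolding eq by simp
qed

text \<open>The point \<open>w = 2\<close> is where the Sonin function gets evaluated. The tail
  bound is \<open>(1 / 180) / (1 - 4 / 25) = 5 / 756\<close>, just below
  \<open>1 / 151\<close>.\<close>

lemma bessel_like'_approx:
  assumes "0 < d" "d \<le> 1 / 1000"
  shows "\<bar>bessel_like' d 2 - (- d - (1 - d) * (1 - 4 * d) / 3 + (1 - d) * (1 - 4 * d) * (1 - 9 * d) / 18)\<bar>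
    \<le> 1 / 151"
proof -
  have "2 < 1 / d"
    using assms by (simp add: field_simps)
  with assms have sm: "summable (\<lambda>n. diffs (bessel_coeff d) n * 2 ^ n)"
    by (intro summable_diffs_bessel_coeff) auto
  have "bessel_like' d 2 = (\<Sum>n. diffs (bessel_coeff d) (n + 4) * 2 ^ (n + 4)) +
          (\<Sum>n<4. diffs (bessel_coeff d) n * 2 ^ n)"
    unfolding bessel_like'_def by (rule suminf_split_initial_segment[OF sm])
  also have "(\<Sum>n<4. diffs (bessel_coeff d) n * 2 ^ n)
      = - d - (1 - d) * (1 - 4 * d) / 3 + (1 - d) * (1 - 4 * d) * (1 - 9 * d) / 18"
    by (simp add: diffs_def lessThan_4 bessel_coeff_values numeral_2_eq_2[symmetric]
        numeral_3_eq_3[symmetric] diff_divide_distrib)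
  finally have eq: "bessel_like' d 2 - (- d - (1 - d) * (1 - 4 * d) / 3 +
      (1 - d) * (1 - 4 * d) * (1 - 9 * d) / 18)
      = (\<Sum>n. diffs (bessel_coeff d) (n + 4) * 2 ^ (n + 4))" by simp
  have b4: "\<bar>bessel_coeff d 4\<bar> \<le> 1 / 576"
    using assms by (simp add: bessel_coeff_values abs_mult mult_le_one)
  have "\<bar>\<Sum>n. diffs (bessel_coeff d) (n + 4) * 2 ^ (n + 4)\<bar> \<le> (1 / 180) / (1 - 4 / 25)"
  proof (rule abs_suminf_le_geometric)
    fix n
    have "\<bar>bessel_coeff d (Suc n + 4)\<bar> \<le> (1 / (real 4 + 1) ^ 2) ^ Suc n * \<bar>bessel_coeff d 4\<bar>"
      using assms by (intro bessel_coeff_geometric) auto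
    also have "\<dots> \<le> (1 / (real 4 + 1) ^ 2) ^ Suc n * (1 / 576)"
      by (intro mult_left_mono b4) auto
    finally have b: "\<bar>bessel_coeff d (Suc n + 4)\<bar> \<le> (1 / 25) ^ Suc n / 576"
      by simp
    \<comment> \<open>This turns the linear factor from differentiation into a power of 2; the ratio
      becomes \<open>2 * 2 / 25\<close>.\<close>
    have n: "real n + 5 \<le> 5 * 2 ^ n"
      by (induction n) auto
    have "\<bar>diffs (bessel_coeff d) (n + 4) * 2 ^ (n + 4)\<bar>
        = (real n + 5) * \<bar>bessel_coeff d (Suc n + 4)\<bar> * 2 ^ (n + 4)"
      by (simp add: diffs_def abs_mult)
    also have "\<dots> \<le> (5 * 2 ^ n) * ((1 / 25) ^ Suc n / 576) * 2 ^ (n + 4)"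
      using b n by (intro mult_right_mono mult_mono) auto
    also have "\<dots> = (1 / 180) * (2 ^ n * (1 / 25) ^ n * 2 ^ n)"
      by (simp add: power_add)
    also have "\<dots> = (1 / 180) * (4 / 25) ^ n"
      by (simp flip: power_mult_distrib)
    finally show "\<bar>diffs (bessel_coeff d) (n + 4) * 2 ^ (n + 4)\<bar> \<le> 1 / 180 * (4 / 25) ^ n" .
  qed auto
  then show ?thesis
    unfolding eq by simp
qed

text \<open>The terms up to degree two are \<open>(1 - w / 2) ^ 2 - d * w ^ 2 / 4\<close>, and the
  rest lies between \<open>- 8 / 7 * B\<close> and \<open>- 6 / 7 * B\<close> with
  \<open>B <= w ^ 3 / 36\<close>; this gives \<open>8 / (7 * 36) = 2 / 63\<close>.\<close>

lemma bessel_like_bounds: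
  assumes "0 < d" "d \<le> 1 / 1000" "0 \<le> w" "w \<le> 2"
  shows "bessel_like d w \<le> (1 - w / 2) ^ 2"
    and "bessel_like d w \<ge> (1 - w / 2) ^ 2 - w ^ 2 / 4000 - 2 / 63 * w ^ 3"
proof -
  define A where "A = (1 - d) * (1 - 4 * d)"
  define B where "B = A / 36 * w ^ 3"
  have A: "0 \<le> A" "A \<le> 1"
    unfolding A_def using assms by (auto intro: mult_le_one)
  then have "A * w ^ 3 \<le> 1 * w ^ 3"
    using assms by (intro mult_right_mono) auto
  then have B: "0 \<le> B" "B \<le> w ^ 3 / 36"
    using assms A by (auto simp: B_def)
  have "d * w ^ 2 \<le> 1 / 1000 * w ^ 2" "0 \<le> d * w ^ 2"
    by (intro mult_right_mono) (use assms in simp_all)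
  moreover have "\<bar>bessel_like d w - (1 - w + (1 - d) / 4 * w ^ 2 - B)\<bar> \<le> B / 7"
    using bessel_like_approx[OF assms] by (simp add: A_def B_def)
  moreover have "1 - w + (1 - d) / 4 * w ^ 2 = (1 - w / 2) ^ 2 - d * w ^ 2 / 4"
    by (simp add: power2_eq_square field_simps)
  ultimately show "bessel_like d w \<le> (1 - w / 2) ^ 2"
    and "bessel_like d w \<ge> (1 - w / 2) ^ 2 - w ^ 2 / 4000 - 2 / 63 * w ^ 3"
    using B by linarith+
qed

text \<open>The value and the derivative at 2 are at most 0.257 and 0.29 in modulus, and
  \<open>0.257^2 + 2 * 0.29^2 < 0.235\<close>. The target \<open>1 / 4\<close> is the square of
  \<open>exp (- ln 2)\<close>.\<close>

lemma sonin_2_le: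
  assumes "0 < d" "d \<le> 1 / 1000"
  shows "sonin d 2 \<le> 1 / 4"
proof -
  define A where "A = (1 - d) * (1 - 4 * d)"
  have d2: "0 \<le> d * d" using assms by simp
  have A: "0 \<le> A" "A \<le> 1"
    unfolding A_def using assms by (auto intro: mult_le_one)
  have "A = 1 - 5 * d + 4 * (d * d)"
    by (simp add: A_def algebra_simps)
  then have A': "A \<ge> 99 / 100"
    using assms d2 by linarith
  define C where "C = A * (1 - 9 * d)"
  have "(99 / 100) * (99 / 100) \<le> C" "C \<le> 1"
    unfolding C_def using A A' assms by (intro mult_mono mult_le_one; simp)+
  moreover have "\<bar>bessel_like' d 2 - (- d - A / 3 + C / 18)\<bar> \<le> 1 / 151"
    using bessel_like'_approx[OF assms] by (simp add: A_def C_def)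
  ultimately have "\<bar>bessel_like' d 2\<bar> \<le> 29 / 100"
    using A A' assms by linarith
  then have "\<bar>bessel_like' d 2\<bar> ^ 2 \<le> (29 / 100) ^ 2"
    by (intro power_mono) auto
  then have 1: "bessel_like' d 2 ^ 2 \<le> (29 / 100) ^ 2"
    by simp
  have "\<bar>bessel_like d 2\<bar> \<le> 257 / 1000"
    using bessel_like_bounds[OF assms, of 2] by simp
  then have "\<bar>bessel_like d 2\<bar> ^ 2 \<le> (257 / 1000) ^ 2"
    by (intro power_mono) auto
  then have 2: "bessel_like d 2 ^ 2 \<le> (257 / 1000) ^ 2"
    by simp
  have "(1 - d * 2) * 2 * bessel_like' d 2 ^ 2 \<le> 2 * (29 / 100) ^ 2"
    using assms 1 by (intro mult_mono) auto
  with 2 show ?thesis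
    unfolding sonin_def by (simp add: power2_eq_square)
qed

lemma abs_bessel_like_le:
  assumes "0 < d" "d \<le> 1 / 1000" "0 \<le> w" "w < 1 / d"
  shows "\<bar>bessel_like d w\<bar> \<le> exp (- min w (ln 2))"
proof -
  have ln2: "2 / 3 \<le> ln (2::real)" "ln (2::real) \<le> 25 / 36"
    by (rule ln2_ge_two_thirds ln2_le_25_over_36)+
  consider "w \<le> ln 2" | "ln 2 \<le> w" "w \<le> 2" | "2 \<le> w"
    by linarith
  then show ?thesis
  proof cases
    case 1
    with ln2 have w: "w \<le> 25 / 36"
      by simp
    note b = bessel_like_bounds[OF assms(1-3)]
    have "(1 - 25 / 72) ^ 2 \<le> (1 - w / 2) ^ 2" "w ^ 2 \<le> 1 ^ 2" "w ^ 3 \<le> 1 ^ 3"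
      using w assms by (intro power_mono; simp)+
    then have "0 \<le> bessel_like d w"
      using b w by (simp add: power2_eq_square)
    \<comment> \<open>The square \<open>(1 - w / 2) ^ 2\<close> is compared with
      \<open>exp (- w)\<close> through its root, by \<open>1 + u <= exp u\<close>.\<close>
    moreover have "bessel_like d w \<le> exp (- (w / 2)) ^ 2"
      using b(1) w exp_ge_add_one_self[of "- (w / 2)"]
      by (intro order.trans[OF b(1)] power_mono) auto
    moreover have "exp (- (w / 2)) ^ 2 = exp (- w)"
      by (simp flip: exp_of_nat_mult)
    ultimately show ?thesis
      using 1 by (simp add: min_def)
  next
    case 2
    note b = bessel_like_bounds[OF assms(1-3) 2(2)]
    \<comment> \<open>From \<open>w >= ln 2 >= 2 / 3\<close> the upper bound is
      \<open>4 / 9\<close>; the lower bound is \<open>- 1 / 1000 - 16 / 63\<close>. Both are within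
      \<open>1 / 2\<close>.\<close>
    have "w ^ 2 \<le> 2 ^ 2" "w ^ 3 \<le> 2 ^ 3" "(1 - w / 2) ^ 2 \<le> (1 - 1 / 3) ^ 2"
      using 2 assms ln2 by (intro power_mono; simp)+
    then have "w ^ 2 \<le> 4" "w ^ 3 \<le> 8" "(1 - w / 2) ^ 2 \<le> 4 / 9"
      by (simp_all add: power2_eq_square)
    moreover have "0 \<le> (1 - w / 2) ^ 2"
      by simp
    ultimately have "\<bar>bessel_like d w\<bar> \<le> 1 / 2"
      using b by linarith
    with 2 show ?thesis
      by (auto simp: min_def exp_minus)
  next
    case 3
    have "bessel_like d w ^ 2 \<le> (1 / 2) ^ 2"
      using bessel_like_sqr_le_sonin[of d w] sonin_antimono[of d 2 w] sonin_2_le[of d] assms 3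
      by (simp add: power2_eq_square)
    then have "\<bar>bessel_like d w\<bar> \<le> 1 / 2"
      using abs_le_square_iff[of "bessel_like d w" "1 / 2"] by simp
    with 3 ln2 show ?thesis
      by (simp add: min_def exp_minus)
  qed
qed

section \<open>The characteristic function of one Euler factor\<close>

text \<open>A real-valued density brings integrals over the circle within reach of
  \<open>integral_density\<close>.\<close>

lemma uniform_circle_eq_distr:
  "uniform_circle = distr (density lborel (\<lambda>t. indicator {0..2 * pi} t / (2 * pi))) borel cis"
proof -
  have "indicator {0..2 * pi} t / ennreal (2 * pi) = ennreal (indicator {0..2 * pi} t / (2 * pi))" for t :: real
    using divide_ennreal[of 1 "2 * pi"] by (auto simp: indicator_def)
  then show ?thesis
    by (simp add: uniform_circle_def uniform_measure_def)
qed

lemma sets_uniform_circle [measurable_cong, simp]: "sets uniform_circle = sets borel"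
  by (simp add: uniform_circle_def)

lemma measurable_cis [measurable]: "cis \<in> borel_measurable borel"
  by (intro borel_measurable_continuous_onI continuous_intros)

lemma measurable_cnj [measurable]: "cnj \<in> borel_measurable borel"
  by (intro borel_measurable_continuous_onI continuous_intros)

lemma prob_space_uniform_circle: "prob_space uniform_circle"
  unfolding uniform_circle_def
proof (rule prob_space.prob_space_distr)
  show "prob_space (uniform_measure lborel {0..2 * pi})"
    by (rule prob_space_uniform_measure) auto
qed measurable

lemma AE_uniform_circle: "AE z in uniform_circle. norm z = 1"
  unfolding uniform_circle_def by (subst AE_distr_iff) auto

lemma integral_uniform_circle:
  fixes f :: "complex \<Rightarrow> complex"
  assumes [measurable]: "f \<in> borel_measurable borel"
  shows "(CLINT z|uniform_circle. f z) = (CLINT t|lborel. indicator {0..2 * pi} t *\<^sub>R (f (cis t) / (2 * pi)))"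
  unfolding uniform_circle_eq_distr
  by (subst integral_distr, measurable, subst integral_density)
    (auto intro!: Bochner_Integration.integral_cong simp: indicator_def scaleR_conv_of_real)

section \<open>Orthogonality and Parseval's identity on the circle\<close>

lemma uniform_circle_moment:
  "(CLINT z|uniform_circle. z ^ m * cnj z ^ n) = of_bool (m = n)"
proof -
  define k where "k = real m - real n"
  have "(CLINT z|uniform_circle. z ^ m * cnj z ^ n)
      = (CLINT t|lborel. indicator {0..2 * pi} t *\<^sub>R (cis (k * t) / (2 * pi)))"
    by (subst integral_uniform_circle)
      (auto intro!: Bochner_Integration.integral_cong
        simp: k_def Complex.DeMoivre cis_cnj cis_mult left_diff_distrib)
  also have "\<dots> = of_bool (m = n)"
  proof (cases "m = n")
    case True
    have "(CLINT t|lborel. indicator {0..2 * pi} t *\<^sub>R ((1 :: complex) / (2 * pi)))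
        = complex_of_real (2 * pi) / of_real (2 * pi) - of_real 0 / of_real (2 * pi)"
      by (intro integral_FTC_Icc[where F = "\<lambda>t. of_real t / of_real (2 * pi)"]) (auto intro!: derivative_eq_intros continuous_intros simp: scaleR_conv_of_real)
    then show ?thesis
      using True by (simp add: k_def)
  next
    case False
    then have k: "k \<noteq> 0"
      by (simp add: k_def)
    have "((\<lambda>t. cis (k * t)) has_vector_derivative \<i> * of_real k * cis (k * t)) (at t within A)" for t A
      unfolding has_vector_derivative_def
      by (rule derivative_eq_intros refl)+ (simp add: fun_eq_iff scaleR_conv_of_real)
    note [derivative_intros] = has_vector_derivative_eq_rhs[OF this]
    have "(CLINT t|lborel. indicator {0..2 * pi} t *\<^sub>R (cis (k * t) / (2 * pi)))
        = cis (k * (2 * pi)) / (\<i> * k * (2 * pi)) - cis (k * 0) / (\<i> * k * (2 * pi))"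
      using k
      by (intro integral_FTC_Icc[where F = "\<lambda>t. cis (k * t) / (\<i> * k * (2 * pi))"])
         (auto intro!: derivative_eq_intros continuous_intros simp: scaleR_conv_of_real)
    moreover have "cis (k * (2 * pi)) = 1"
      using cis_multiple_2pi[of "of_int (int m - int n)"] by (simp add: k_def mult_ac)
    ultimately show ?thesis
      using False by simp
  qed
  finally show ?thesis .
qed

text \<open>On the circle the terms are dominated by the summable \<open>norm (a n) * K\<close>, so
  sum and integral may be exchanged.\<close>

lemma integral_power_series_uniform_circle:
  fixes a :: "nat \<Rightarrow> complex" and g :: "complex \<Rightarrow> complex"
  assumes a: "summable (\<lambda>n. norm (a n))"
    and [measurable]: "g \<in> borel_measurable borel"
    and g: "\<And>z. norm z = 1 \<Longrightarrow> norm (g z) \<le> K"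
  shows "(\<lambda>n. a n * (CLINT z|uniform_circle. z ^ n * g z)) sums
    (CLINT z|uniform_circle. (\<Sum>n. a n * z ^ n) * g z)"
proof -
  interpret prob_space uniform_circle
    by (rule prob_space_uniform_circle)
  have b: "norm (a n * z ^ n * g z) \<le> norm (a n) * K" if "norm z = 1" for n z
    using g[OF that] that by (simp add: norm_mult norm_power mult_left_mono)
  have int: "integrable uniform_circle (\<lambda>z. a n * z ^ n * g z)" for n
    by (rule integrable_const_bound[where B = "norm (a n) * K"]) (use AE_uniform_circle b in auto)
  have K: "summable (\<lambda>n. norm (a n) * K)"
    using a by (rule summable_mult2)
  have "(\<lambda>n. CLINT z|uniform_circle. a n * z ^ n * g z) sums
      (CLINT z|uniform_circle. (\<Sum>n. a n * z ^ n * g z))"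
  proof (rule sums_integral[OF int])
    show "AE z in uniform_circle. summable (\<lambda>n. norm (a n * z ^ n * g z))"
      using AE_uniform_circle
      by eventually_elim (rule summable_comparison_test[OF _ K], use b in auto)
    have "norm (LINT z|uniform_circle. norm (a n * z ^ n * g z)) \<le> norm (a n) * K" for n
    proof -
      have "(LINT z|uniform_circle. norm (a n * z ^ n * g z)) \<le> (LINT z|uniform_circle. norm (a n) * K)"
        using AE_uniform_circle by (intro integral_mono_AE integrable_norm int) (auto elim!: eventually_mono dest!: b)
      then show ?thesis
        by (simp add: prob_space)
    qed
    then show "summable (\<lambda>n. LINT z|uniform_circle. norm (a n * z ^ n * g z))"
      by (intro summable_comparison_test[OF _ K]) auto
  qed
  also have "(\<lambda>n. CLINT z|uniform_circle. a n * z ^ n * g z)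
      = (\<lambda>n. a n * (CLINT z|uniform_circle. z ^ n * g z))"
    by (simp add: mult.assoc)
  also have "(CLINT z|uniform_circle. (\<Sum>n. a n * z ^ n * g z))
      = (CLINT z|uniform_circle. (\<Sum>n. a n * z ^ n) * g z)"
  proof (rule integral_cong_AE)
    show "AE z in uniform_circle. (\<Sum>n. a n * z ^ n * g z) = (\<Sum>n. a n * z ^ n) * g z"
      using AE_uniform_circle
    proof eventually_elim
      case (elim z)
      then have "summable (\<lambda>n. a n * z ^ n)"
        by (intro summable_norm_cancel[of "\<lambda>n. a n * z ^ n"]) (use a in \<open>simp add: norm_mult norm_power\<close>)
      then show ?case
        by (simp add: suminf_mult2)
    qed
  qed auto
  finally show ?thesis .
qed

text \<open>The exchange of sum and integral is used twice: with \<open>g z = cnj z ^ n\<close> it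
  extracts the coefficient \<open>b n\<close>, and with \<open>g\<close> the conjugate of the second
  series it gives the identity.\<close>

lemma uniform_circle_parseval:
  fixes a b :: "nat \<Rightarrow> complex"
  assumes a: "summable (\<lambda>n. norm (a n))" and b: "summable (\<lambda>n. norm (b n))"
  shows "(\<lambda>n. a n * cnj (b n)) sums
    (CLINT z|uniform_circle. (\<Sum>n. a n * z ^ n) * cnj (\<Sum>n. b n * z ^ n))"
proof -
  have coeff: "(CLINT z|uniform_circle. z ^ n * cnj (\<Sum>m. b m * z ^ m)) = cnj (b n)" for n
  proof -
    have "(\<lambda>m. b m * (CLINT z|uniform_circle. z ^ m * cnj z ^ n)) sums
        (CLINT z|uniform_circle. (\<Sum>m. b m * z ^ m) * cnj z ^ n)"
      by (rule integral_power_series_uniform_circle[OF b, where K = 1]) (auto simp: norm_power)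
    moreover have "(\<lambda>m. b m * (CLINT z|uniform_circle. z ^ m * cnj z ^ n)) sums b n"
      using sums_single[of n b] by (simp add: uniform_circle_moment of_bool_def if_distrib cong: if_cong)
    ultimately have "b n = (CLINT z|uniform_circle. (\<Sum>m. b m * z ^ m) * cnj z ^ n)"
      by (rule sums_unique2[rotated])
    then have "cnj (b n) = (CLINT z|uniform_circle. cnj ((\<Sum>m. b m * z ^ m) * cnj z ^ n))"
      by (simp only: Bochner_Integration.integral_cnj)
    then show ?thesis
      by (simp add: mult.commute)
  qed
  have bound: "norm (cnj (\<Sum>m. b m * z ^ m)) \<le> (\<Sum>m. norm (b m))" if "norm z = 1" for z
    using summable_norm[of "\<lambda>m. b m * z ^ m"] b that by (simp add: norm_mult norm_power)
  show ?thesis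
    using integral_power_series_uniform_circle[OF a, where g = "\<lambda>z. cnj (\<Sum>n. b n * z ^ n)" and K = "\<Sum>m. norm (b m)"] bound
    by (simp add: coeff)
qed

section \<open>Binomial expansion of one Euler factor\<close>

lemma of_real_gbinomial: "of_real a gchoose n = (of_real (a gchoose n) :: complex)"
  by (simp add: gbinomial_prod_rev)

text \<open>Both sides have the same ratio of successive terms, because \<open>(- x / 2 - n) * (x /
  2 - n) = - (x^2 / 4) * (1 - 4 * n^2 / x^2)\<close>.\<close>

lemma bessel_coeff_eq_gbinomial:
  assumes "x \<noteq> 0"
  shows "bessel_coeff (4 / x\<^sup>2) n * (x\<^sup>2 * r\<^sup>2 / 4) ^ n
    = ((- (x / 2) gchoose n) * (- r) ^ n) * ((x / 2 gchoose n) * (- r) ^ n)"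
proof (induction n)
  case 0
  show ?case by (simp add: bessel_coeff_0)
next
  case (Suc n)
  have g: "a gchoose Suc n = (a gchoose n) * (a - real n) / (real n + 1)" for a :: real
    by (simp add: gbinomial_prod_rev field_simps)
  have c: "- (1 - 4 / x\<^sup>2 * (real n)\<^sup>2) / (real n + 1)\<^sup>2 * (x\<^sup>2 * r\<^sup>2 / 4)
      = ((- (x / 2) - real n) / (real n + 1) * (- r)) * ((x / 2 - real n) / (real n + 1) * (- r))"
    using assms by (simp add: divide_simps) (simp add: algebra_simps power2_eq_square)
  show ?case
    using arg_cong2[OF c Suc.IH, of "(*)"] by (simp only: bessel_coeff_Suc g power_Suc mult_ac times_divide_eq_right times_divide_eq_left)
qed

text \<open>The binomial series converges at \<open>(1 + r) / 2\<close>, which lies strictly between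
  \<open>r\<close> and 1; a power series converges absolutely at points of smaller modulus.\<close>

lemma summable_norm_gbinomial:
  assumes "0 \<le> r" "r < 1"
  shows "summable (\<lambda>n. norm ((of_real a gchoose n) * of_real (- r) ^ n :: complex))"
proof (rule powser_insidea[where x = "of_real ((1 + r) / 2)"])
  show "summable (\<lambda>n. (complex_of_real a gchoose n) * of_real ((1 + r) / 2) ^ n)"
    by (rule sums_summable[OF gen_binomial_complex]) (use assms in \<open>simp del: of_real_add of_real_divide\<close>)
qed (use assms in \<open>simp del: of_real_add of_real_divide\<close>)

lemma measurable_char_Ln [measurable]:
  "(\<lambda>z. exp (- (\<i> * of_real x * of_real (Im (Ln (1 - of_real r * z)))))) \<in> borel_measurable borel"
proof -
  note [measurable] = borel_measurable_Ln
  show ?thesis by measurable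
qed

lemma integral_uniform_circle_eq_bessel_like:
  assumes "x \<noteq> 0" "0 \<le> r" "r < 1"
  shows "(CLINT z|uniform_circle. exp (- (\<i> * of_real x * of_real (Im (Ln (1 - of_real r * z))))))
    = of_real (bessel_like (4 / x\<^sup>2) (x\<^sup>2 * r\<^sup>2 / 4))"
proof -
  define a where "a = (\<lambda>c n. (complex_of_real c gchoose n) * of_real (- r) ^ n)"
  have pow: "(\<Sum>n. a c n * z ^ n) = exp (of_real c * Ln (1 - of_real r * z))" if "norm z = 1" for c z
  proof -
    have n: "norm (- of_real r * z) < 1"
      using that assms by (simp add: norm_mult)
    then have "1 - of_real r * z \<noteq> 0"
      by auto
    moreover from gen_binomial_complex[OF n, of "of_real c"]
    have "(\<lambda>m. a c m * z ^ m) sums (1 - of_real r * z) powr of_real c"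
      by (simp add: a_def power_mult_distrib[symmetric] mult.assoc)
    ultimately show ?thesis
      by (simp add: sums_iff powr_def)
  qed
  have "(\<lambda>n. a (- (x / 2)) n * cnj (a (x / 2) n)) sums
      (CLINT z|uniform_circle. (\<Sum>n. a (- (x / 2)) n * z ^ n) * cnj (\<Sum>n. a (x / 2) n * z ^ n))"
    unfolding a_def by (intro uniform_circle_parseval summable_norm_gbinomial assms)
  also have "(\<lambda>n. a (- (x / 2)) n * cnj (a (x / 2) n))
      = (\<lambda>n. of_real (bessel_coeff (4 / x\<^sup>2) n * (x\<^sup>2 * r\<^sup>2 / 4) ^ n))"
    unfolding bessel_coeff_eq_gbinomial[OF assms(1)] a_def of_real_gbinomial by simp
  also have "(CLINT z|uniform_circle. (\<Sum>n. a (- (x / 2)) n * z ^ n) * cnj (\<Sum>n. a (x / 2) n * z ^ n))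
      = (CLINT z|uniform_circle. exp (- (\<i> * of_real x * of_real (Im (Ln (1 - of_real r * z))))))"
  proof (rule integral_cong_AE)
    show "AE z in uniform_circle. (\<Sum>n. a (- (x / 2)) n * z ^ n) * cnj (\<Sum>n. a (x / 2) n * z ^ n)
      = exp (- (\<i> * of_real x * of_real (Im (Ln (1 - of_real r * z)))))"
      using AE_uniform_circle
    proof eventually_elim
      case (elim z)
      define L where "L = Ln (1 - of_real r * z)"
      have "(\<Sum>n. a (- (x / 2)) n * z ^ n) * cnj (\<Sum>n. a (x / 2) n * z ^ n)
          = exp (of_real (- (x / 2)) * L + of_real (x / 2) * cnj L)"
        unfolding pow[OF elim] by (simp only: exp_cnj exp_add complex_cnj_mult complex_cnj_complex_of_real L_def)
      \<comment> \<open>Here \<open>L - cnj L = 2 * i * Im L\<close> splits the phase into a factor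
        holomorphic in \<open>z\<close> and a conjugate one.\<close>
      also have "of_real (- (x / 2)) * L + of_real (x / 2) * cnj L = - (\<i> * of_real x * of_real (Im L))"
        by (auto simp: complex_eq_iff)
      finally show ?case
        unfolding L_def .
    qed
  qed auto
  finally have "(\<lambda>n. complex_of_real (bessel_coeff (4 / x\<^sup>2) n * (x\<^sup>2 * r\<^sup>2 / 4) ^ n)) sums
      (CLINT z|uniform_circle. exp (- (\<i> * of_real x * of_real (Im (Ln (1 - of_real r * z))))))" .
  \<comment> \<open>The condition \<open>r < 1\<close> places the argument inside the radius of
    convergence \<open>x^2 / 4\<close>.\<close>
  moreover have "x\<^sup>2 * r\<^sup>2 / 4 < 1 / (4 / x\<^sup>2)"
    using assms power_strict_mono[of r 1 2] by simp
  then have "(\<lambda>n. bessel_coeff (4 / x\<^sup>2) n * (x\<^sup>2 * r\<^sup>2 / 4) ^ n) sums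
      bessel_like (4 / x\<^sup>2) (x\<^sup>2 * r\<^sup>2 / 4)"
    unfolding bessel_like_def using assms by (intro summable_sums summable_bessel_coeff) auto
  then have "(\<lambda>n. complex_of_real (bessel_coeff (4 / x\<^sup>2) n * (x\<^sup>2 * r\<^sup>2 / 4) ^ n)) sums
      of_real (bessel_like (4 / x\<^sup>2) (x\<^sup>2 * r\<^sup>2 / 4))"
    by (rule sums_of_real)
  ultimately show ?thesis
    by (rule sums_unique2)
qed

section \<open>Almost sure convergence of the Euler product\<close>

context prob_space
begin

lemma indep_vars_imp_indep_var:
  assumes "indep_vars (\<lambda>_. N) X I" "i \<in> I" "j \<in> I" "i \<noteq> j"
  shows "indep_var N (X i) N (X j)"
proof -
  have "indep_var N ((\<lambda>f. f i) \<circ> (\<lambda>\<omega>. restrict (\<lambda>k. X k \<omega>) {i}))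
      N ((\<lambda>f. f j) \<circ> (\<lambda>\<omega>. restrict (\<lambda>k. X k \<omega>) {j}))"
    using assms by (intro indep_var_compose[OF indep_var_restrict[OF assms(1)]]) auto
  then show ?thesis
    by (simp add: comp_def)
qed

text \<open>Expanding the square, the off-diagonal products have expectation 0 by independence and
  zero mean. Almost surely constant moduli make all products integrable.\<close>

lemma second_moment_sum_indep:
  fixes X :: "'i \<Rightarrow> 'a \<Rightarrow> complex"
  assumes ind: "indep_vars (\<lambda>_. borel) X I" and A: "finite A" "A \<subseteq> I"
    and norm: "\<And>i. i \<in> I \<Longrightarrow> AE \<omega> in M. norm (X i \<omega>) = a i"
    and mean: "\<And>i. i \<in> I \<Longrightarrow> expectation (X i) = 0"
  shows "expectation (\<lambda>\<omega>. norm (\<Sum>i\<in>A. X i \<omega>) ^ 2) = (\<Sum>i\<in>A. a i ^ 2)"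
    and "integrable M (\<lambda>\<omega>. norm (\<Sum>i\<in>A. X i \<omega>) ^ 2)"
proof -
  have rv [measurable]: "X i \<in> borel_measurable M" if "i \<in> A" for i
    using ind that A by (auto simp: indep_vars_def)
  have norm': "AE \<omega> in M. norm (X i \<omega>) = a i" if "i \<in> A" for i
    using norm that A by auto
  have int: "integrable M (X i)" if "i \<in> A" for i
    using norm'[OF that] that
    by (intro integrable_const_bound[where B = "a i"]) (auto elim!: eventually_mono)
  have int2: "integrable M (\<lambda>\<omega>. X i \<omega> * cnj (X j \<omega>))" if "i \<in> A" "j \<in> A" for i j
  proof (rule integrable_const_bound[where B = "a i * a j"])
    show "AE \<omega> in M. norm (X i \<omega> * cnj (X j \<omega>)) \<le> a i * a j"
      using norm'[OF that(1)] norm'[OF that(2)] by eventually_elim (simp add: norm_mult)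
  qed (use that in measurable)
  have cross: "expectation (\<lambda>\<omega>. X i \<omega> * cnj (X j \<omega>)) = (if i = j then of_real (a i ^ 2) else 0)"
    if "i \<in> A" "j \<in> A" for i j
  proof (cases "i = j")
    case True
    have "AE \<omega> in M. X i \<omega> * cnj (X j \<omega>) = of_real (a i ^ 2)"
      using norm'[OF that(2)] by (auto simp: True complex_norm_square[symmetric] elim!: eventually_mono)
    then have "expectation (\<lambda>\<omega>. X i \<omega> * cnj (X j \<omega>)) = expectation (\<lambda>\<omega>. of_real (a i ^ 2))"
      using that by (intro integral_cong_AE) auto
    with True show ?thesis
      by (simp add: prob_space)
  next
    case False
    have "indep_var borel (X i) borel (X j)"
      using that A False by (intro indep_vars_imp_indep_var[OF ind]) auto
    then have "indep_var borel ((\<lambda>z. z) \<circ> X i) borel (cnj \<circ> X j)"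
      by (rule indep_var_compose) (auto intro: borel_measurable_continuous_onI continuous_intros)
    then have "expectation (\<lambda>\<omega>. X i \<omega> * cnj (X j \<omega>)) = expectation (X i) * expectation (\<lambda>\<omega>. cnj (X j \<omega>))"
      using that int by (intro indep_var_lebesgue_integral) (auto simp: comp_def)
    with False that A show ?thesis
      by (simp add: mean subset_iff)
  qed
  have eq: "complex_of_real (norm (\<Sum>i\<in>A. X i \<omega>) ^ 2) = (\<Sum>i\<in>A. \<Sum>j\<in>A. X i \<omega> * cnj (X j \<omega>))" for \<omega>
    by (simp only: complex_norm_square cnj_sum sum_product)
  have "integrable M (\<lambda>\<omega>. complex_of_real (norm (\<Sum>i\<in>A. X i \<omega>) ^ 2))"
    unfolding eq by (intro Bochner_Integration.integrable_sum int2)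
  then show "integrable M (\<lambda>\<omega>. norm (\<Sum>i\<in>A. X i \<omega>) ^ 2)"
    by (simp only: complex_of_real_integrable_eq)
  have "complex_of_real (expectation (\<lambda>\<omega>. norm (\<Sum>i\<in>A. X i \<omega>) ^ 2))
      = expectation (\<lambda>\<omega>. complex_of_real (norm (\<Sum>i\<in>A. X i \<omega>) ^ 2))"
    by (simp only: integral_complex_of_real)
  also have "\<dots> = (\<Sum>i\<in>A. \<Sum>j\<in>A. expectation (\<lambda>\<omega>. X i \<omega> * cnj (X j \<omega>)))"
    unfolding eq by (simp add: Bochner_Integration.integral_sum int2)
  also have "\<dots> = (\<Sum>i\<in>A. \<Sum>j\<in>A. if i = j then of_real (a i ^ 2) else 0)"
    by (intro sum.cong refl cross)
  also have "\<dots> = of_real (\<Sum>i\<in>A. a i ^ 2)"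
    using A by simp
  finally show "expectation (\<lambda>\<omega>. norm (\<Sum>i\<in>A. X i \<omega>) ^ 2) = (\<Sum>i\<in>A. a i ^ 2)"
    by (simp only: of_real_eq_iff)
qed

text \<open>Split by the first \<open>k\<close> with \<open>norm (S m k) > 2 * t\<close>, the event
  \<open>A k\<close>. It is independent of \<open>B k\<close>, which says that the remaining sum is
  at most \<open>t\<close> and has probability at least \<open>1 / 2\<close>; where both hold,
  \<open>norm (S m n) > t\<close>.\<close>

lemma ottaviani_inequality:
  fixes X :: "nat \<Rightarrow> 'a \<Rightarrow> 'b :: {real_normed_vector, second_countable_topology}"
  assumes ind: "indep_vars (\<lambda>_. borel) X I"
    and S: "\<And>m n \<omega>. S m n \<omega> = (\<Sum>i\<in>I \<inter> {m..<n}. X i \<omega>)"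
    and tail: "\<And>k. m \<le> k \<Longrightarrow> k \<le> n \<Longrightarrow> prob {\<omega> \<in> space M. norm (S k n \<omega>) > t} \<le> 1 / 2"
  shows "prob {\<omega> \<in> space M. \<exists>k\<in>{m..n}. norm (S m k \<omega>) > 2 * t}
    \<le> 2 * prob {\<omega> \<in> space M. norm (S m n \<omega>) > t}"
proof -
  have rv [measurable]: "X i \<in> borel_measurable M" if "i \<in> I" for i
    using ind that by (auto simp: indep_vars_def)
  have [measurable]: "S j k \<in> borel_measurable M" for j k
    unfolding S [abs_def] by (rule borel_measurable_sum) auto
  define A where "A = (\<lambda>k. {\<omega> \<in> space M. 2 * t < norm (S m k \<omega>) \<and> (\<forall>j\<in>{m..<k}. \<not> 2 * t < norm (S m j \<omega>))})"
  define B where "B = (\<lambda>k. {\<omega> \<in> space M. norm (S k n \<omega>) \<le> t})"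
  have [measurable]: "A k \<in> events" "B k \<in> events" for k
    unfolding A_def B_def by measurable
  have indep: "prob (A k \<inter> B k) = prob (A k) * prob (B k)" for k
  proof -
    \<comment> \<open>\<open>A k\<close> depends only on the indices below \<open>k\<close>,
      \<open>B k\<close> only on those from \<open>k\<close> on. Both are written as preimages under
      the two restricted families, to which independence of disjoint blocks applies.\<close>
    let ?J = "I \<inter> {m..<k}" and ?K = "I \<inter> {k..<n}"
    let ?PJ = "Pi\<^sub>M ?J (\<lambda>_. borel :: 'b measure)" and ?PK = "Pi\<^sub>M ?K (\<lambda>_. borel :: 'b measure)"
    define f where "f = (\<lambda>j (x :: nat \<Rightarrow> 'b). \<Sum>i\<in>I \<inter> {m..<j}. x i)"
    have [measurable]: "f j \<in> borel_measurable ?PJ" if "j \<in> {m..k}" for j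
      unfolding f_def using that by (intro borel_measurable_sum measurable_component_singleton) auto
    have [measurable]: "(\<lambda>x. \<Sum>i\<in>?K. x i) \<in> borel_measurable ?PK"
      by (intro borel_measurable_sum measurable_component_singleton) auto
    define A' where "A' = {x \<in> space ?PJ. 2 * t < norm (f k x) \<and> (\<forall>j\<in>{m..<k}. \<not> 2 * t < norm (f j x))}"
    define B' where "B' = {x \<in> space ?PK. norm (\<Sum>i\<in>?K. x i) \<le> t}"
    have "A' \<in> sets ?PJ"
    proof (cases "m \<le> k")
      case True
      have "{x \<in> space ?PJ. \<forall>j\<in>{m..<k}. \<not> 2 * t < norm (f j x)} \<in> sets ?PJ"
        by (intro sets.sets_Collect_finite_All) auto
      moreover have "{x \<in> space ?PJ. 2 * t < norm (f k x)} \<in> sets ?PJ"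
        using True by auto
      ultimately show ?thesis
        unfolding A'_def by (intro sets.sets_Collect_conj)
    next
      case False
      \<comment> \<open>Here \<open>k < m\<close>: the sum \<open>f k x\<close> is empty and the
        condition on earlier \<open>j\<close> is vacuous.\<close>
      then have "A' = {x \<in> space ?PJ. 2 * t < 0}"
        unfolding A'_def f_def by auto
      then show ?thesis by simp
    qed
    moreover have "B' \<in> sets ?PK"
      unfolding B'_def by measurable
    moreover have "indep_var ?PJ (\<lambda>\<omega>. restrict (\<lambda>i. X i \<omega>) ?J) ?PK (\<lambda>\<omega>. restrict (\<lambda>i. X i \<omega>) ?K)"
      by (rule indep_var_restrict[OF ind]) auto
    ultimately have "prob ((\<lambda>x. (restrict (\<lambda>i. X i x) ?J, restrict (\<lambda>i. X i x) ?K)) -` (A' \<times> B') \<inter> space M)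
      = prob ((\<lambda>x. restrict (\<lambda>i. X i x) ?J) -` A' \<inter> space M) * prob ((\<lambda>x. restrict (\<lambda>i. X i x) ?K) -` B' \<inter> space M)"
      by (intro indep_varD)
    moreover have f: "f j (restrict (\<lambda>i. X i \<omega>) ?J) = S m j \<omega>" if "j \<le> k" for j \<omega>
      unfolding f_def S using that by (intro sum.cong) auto
    have A': "(\<lambda>x. restrict (\<lambda>i. X i x) ?J) -` A' \<inter> space M = A k"
      unfolding A_def A'_def by (auto simp: space_PiM f)
    moreover have B': "(\<lambda>x. restrict (\<lambda>i. X i x) ?K) -` B' \<inter> space M = B k"
      unfolding B_def B'_def S by (auto simp: space_PiM)
    moreover have "(\<lambda>x. (restrict (\<lambda>i. X i x) ?J, restrict (\<lambda>i. X i x) ?K)) -` (A' \<times> B') \<inter> space M = A k \<inter> B k"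
      unfolding A'[symmetric] B'[symmetric] by auto
    ultimately show ?thesis
      by simp
  qed
  have half: "prob (A k) \<le> 2 * prob (A k \<inter> B k)" if "k \<in> {m..n}" for k
  proof -
    have "B k = space M - {\<omega> \<in> space M. norm (S k n \<omega>) > t}"
      unfolding B_def by auto
    then have "prob (B k) = 1 - prob {\<omega> \<in> space M. norm (S k n \<omega>) > t}"
      by (simp add: prob_compl)
    with tail[of k] that have "1 / 2 \<le> prob (B k)"
      by simp
    then have "prob (A k) * (1 / 2) \<le> prob (A k) * prob (B k)"
      by (intro mult_left_mono) auto
    then show ?thesis
      unfolding indep by simp
  qed
  have disj: "disjoint_family_on A {m..n}"
    unfolding disjoint_family_on_def A_def
    by (auto simp: not_less) (metis atLeastLessThan_iff linorder_neqE_nat not_less)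
  have "{\<omega> \<in> space M. \<exists>k\<in>{m..n}. norm (S m k \<omega>) > 2 * t} = (\<Union>k\<in>{m..n}. A k)"
  proof (intro equalityI subsetI)
    fix \<omega> assume "\<omega> \<in> {\<omega> \<in> space M. \<exists>k\<in>{m..n}. norm (S m k \<omega>) > 2 * t}"
    then have \<omega>: "\<omega> \<in> space M" and "\<exists>k. m \<le> k \<and> k \<le> n \<and> norm (S m k \<omega>) > 2 * t"
      by auto
    then obtain k where k: "m \<le> k \<and> k \<le> n \<and> norm (S m k \<omega>) > 2 * t"
      and least: "\<And>j. j < k \<Longrightarrow> \<not> (m \<le> j \<and> j \<le> n \<and> norm (S m j \<omega>) > 2 * t)"
      using exists_least_iff[of "\<lambda>k. m \<le> k \<and> k \<le> n \<and> norm (S m k \<omega>) > 2 * t"] by blast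
    then have "\<omega> \<in> A k"
      unfolding A_def using \<omega> by fastforce
    with k show "\<omega> \<in> (\<Union>k\<in>{m..n}. A k)"
      by auto
  qed (auto simp: A_def)
  then have "prob {\<omega> \<in> space M. \<exists>k\<in>{m..n}. norm (S m k \<omega>) > 2 * t} = (\<Sum>k\<in>{m..n}. prob (A k))"
    using disj by (simp add: finite_measure_finite_Union image_subset_iff)
  also have "\<dots> \<le> (\<Sum>k\<in>{m..n}. 2 * prob (A k \<inter> B k))"
    by (intro sum_mono half)
  also have "\<dots> = 2 * prob (\<Union>k\<in>{m..n}. A k \<inter> B k)"
    using disj by (subst finite_measure_finite_Union)
      (auto simp: sum_distrib_left disjoint_family_on_def image_subset_iff)
  also have "prob (\<Union>k\<in>{m..n}. A k \<inter> B k) \<le> prob {\<omega> \<in> space M. norm (S m n \<omega>) > t}"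
  proof (rule finite_measure_mono)
    show "(\<Union>k\<in>{m..n}. A k \<inter> B k) \<subseteq> {\<omega> \<in> space M. norm (S m n \<omega>) > t}"
    proof clarsimp
      fix \<omega> k assume k: "m \<le> k" "k \<le> n" and \<omega>: "\<omega> \<in> A k" "\<omega> \<in> B k"
      have "S m n \<omega> = S m k \<omega> + S k n \<omega>"
        unfolding S using k by (subst sum.union_disjoint[symmetric]) (auto intro!: sum.cong)
      then have "norm (S m k \<omega>) \<le> norm (S m n \<omega>) + norm (S k n \<omega>)"
        by (metis add_diff_cancel_right' norm_triangle_ineq4)
      with \<omega> show "\<omega> \<in> space M \<and> t < norm (S m n \<omega>)"
        by (auto simp: A_def B_def)
    qed
  qed measurable
  finally show ?thesis
    by simp
qed

text \<open>Kolmogorov's argument: small tails of the variances give small tail sums by Chebyshev's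
  inequality, and Ottaviani's inequality makes this uniform over the partial sums. Almost surely the
  partial sums are then Cauchy.\<close>

lemma AE_summable_indep:
  fixes X :: "nat \<Rightarrow> 'a \<Rightarrow> complex"
  assumes ind: "indep_vars (\<lambda>_. borel) X I"
    and norm: "\<And>i. i \<in> I \<Longrightarrow> AE \<omega> in M. norm (X i \<omega>) = a i"
    and mean: "\<And>i. i \<in> I \<Longrightarrow> expectation (X i) = 0"
    and sm: "summable (\<lambda>i. if i \<in> I then a i ^ 2 else 0)"
  shows "AE \<omega> in M. summable (\<lambda>i. if i \<in> I then X i \<omega> else 0)"
proof -
  define S where "S m n \<omega> = (\<Sum>i\<in>I \<inter> {m..<n}. X i \<omega>)" for m n \<omega>
  have rv: "X i \<in> borel_measurable M" if "i \<in> I" for i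
    using ind that by (auto simp: indep_vars_def)
  have [measurable]: "S j k \<in> borel_measurable M" for j k
    unfolding S_def [abs_def] by (intro borel_measurable_sum rv) auto
  have null: "AE \<omega> in M. \<exists>m. \<forall>k\<ge>m. norm (S m k \<omega>) \<le> 2 * t" if t: "t > 0" for t
  proof -
    define E where "E = (\<lambda>m n. {\<omega> \<in> space M. \<exists>k\<in>{m..n}. norm (S m k \<omega>) > 2 * t})"
    \<comment> \<open>The exceptional event: no starting index keeps all later partial sums within
      \<open>2 * t\<close>.\<close>
    define D where "D = {\<omega> \<in> space M. \<forall>m. \<exists>k\<ge>m. norm (S m k \<omega>) > 2 * t}"
    have [measurable]: "E m n \<in> events" "D \<in> events" for m n
      unfolding E_def D_def by measurable
    have "prob D \<le> 2 * h" if h: "0 < h" "h \<le> 1 / 2" for h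
    proof -
      \<comment> \<open>Chebyshev's inequality divides by \<open>t^2\<close>, leaving
        \<open>h\<close>; the bound \<open>h <= 1 / 2\<close> then meets the tail condition of
        Ottaviani's inequality.\<close>
      have "h * t\<^sup>2 > 0"
        using h t by simp
      then obtain m where m: "\<And>k n. m \<le> k \<Longrightarrow> norm (\<Sum>i=k..<n. if i \<in> I then a i ^ 2 else 0) < h * t\<^sup>2"
        using sm unfolding summable_Cauchy by meson
      have cheb: "prob {\<omega> \<in> space M. norm (S k n \<omega>) > t} \<le> h" if "m \<le> k" for k n
      proof -
        have "prob {\<omega> \<in> space M. norm (S k n \<omega>) > t} \<le> prob {\<omega> \<in> space M. norm (S k n \<omega>) ^ 2 \<ge> t\<^sup>2}"
          using t by (intro finite_measure_mono) (auto intro: power_mono)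
        also have "\<dots> \<le> expectation (\<lambda>\<omega>. norm (S k n \<omega>) ^ 2) / t\<^sup>2"
          using t second_moment_sum_indep(2)[OF ind _ _ norm mean, of "I \<inter> {k..<n}"]
          by (intro integral_Markov_inequality_measure[where A = "{}"]) (auto simp: S_def)
        also have "expectation (\<lambda>\<omega>. norm (S k n \<omega>) ^ 2) = (\<Sum>i\<in>I \<inter> {k..<n}. a i ^ 2)"
          unfolding S_def by (intro second_moment_sum_indep(1)[OF ind _ _ norm mean]) auto
        also have "\<dots> = (\<Sum>i=k..<n. if i \<in> I then a i ^ 2 else 0)"
          by (subst Int_commute, subst sum.inter_restrict) auto
        also have "\<dots> / t\<^sup>2 \<le> h * t\<^sup>2 / t\<^sup>2"
          using m[OF that, of n] by (intro divide_right_mono) auto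
        finally show ?thesis
          using t by simp
      qed
      have E: "prob (E m n) \<le> 2 * h" for n
      proof -
        have "prob (E m n) \<le> 2 * prob {\<omega> \<in> space M. norm (S m n \<omega>) > t}"
          unfolding E_def
          by (rule ottaviani_inequality[OF ind S_def order.trans[OF cheb h(2)]])
        with cheb[of m n] show ?thesis
          by simp
      qed
      have "(\<lambda>n. prob (E m n)) \<longlonglongrightarrow> prob (\<Union>n. E m n)"
        by (intro finite_Lim_measure_incseq) (auto simp: incseq_def E_def)
      then have "prob (\<Union>n. E m n) \<le> 2 * h"
        by (rule LIMSEQ_le_const2) (use E in auto)
      moreover have "prob D \<le> prob (\<Union>n. E m n)"
      proof (rule finite_measure_mono)
        show "D \<subseteq> (\<Union>n. E m n)"
        proof
          fix \<omega> assume "\<omega> \<in> D"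
          then obtain k where "\<omega> \<in> space M" "k \<ge> m" "norm (S m k \<omega>) > 2 * t"
            unfolding D_def by blast
          then have "\<omega> \<in> E m k"
            unfolding E_def by auto
          then show "\<omega> \<in> (\<Union>n. E m n)"
            by auto
        qed
      qed measurable
      ultimately show ?thesis
        by simp
    qed
    note D = this
    have "prob D \<le> 0"
    proof (rule field_le_epsilon)
      fix e :: real assume "e > 0"
      \<comment> \<open>The bound applies to \<open>h = e / 2 <= 1 / 2\<close>; for
        \<open>e > 1\<close> the probability is at most 1 anyway.\<close>
      then show "prob D \<le> 0 + e"
        using D[of "e / 2"] prob_le_1[of D] by (cases "e \<le> 1"; linarith)
    qed
    then have "AE \<omega> in M. \<omega> \<notin> D"
      by (intro AE_not_in null_setsI) (auto simp: emeasure_eq_measure measure_le_0_iff)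
    then show ?thesis
      by (rule AE_mp) (rule AE_I2, force simp: D_def not_less)
  qed
  have "AE \<omega> in M. \<forall>j. \<exists>m. \<forall>k\<ge>m. norm (S m k \<omega>) \<le> 2 * (1 / real (Suc j))"
    unfolding AE_all_countable by (intro allI null) auto
  then show ?thesis
  proof eventually_elim
    case (elim \<omega>)
    have sum_eq: "(\<Sum>i=k..<n. if i \<in> I then X i \<omega> else 0) = S k n \<omega>" for k n
      unfolding S_def by (subst Int_commute, subst sum.inter_restrict) auto
    show ?case
      unfolding summable_Cauchy sum_eq
    proof (intro allI impI)
      fix e :: real assume "e > 0"
      \<comment> \<open>Two sums of norm at most \<open>2 / Suc j\<close> are combined below, hence
        a quarter of \<open>e\<close>.\<close>
      then obtain j where j: "1 / real (Suc j) < e / 4"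
        using nat_approx_posE[of "e / 4"] by auto
      obtain m where m: "\<And>k. k \<ge> m \<Longrightarrow> norm (S m k \<omega>) \<le> 2 * (1 / real (Suc j))"
        using elim by blast
      have "norm (S k n \<omega>) < e" if "m \<le> k" for k n
      proof (cases "k \<le> n")
        case True
        have "S m n \<omega> = S m k \<omega> + S k n \<omega>"
          unfolding S_def using that True by (subst sum.union_disjoint[symmetric]) (auto intro!: sum.cong)
        then have "norm (S k n \<omega>) \<le> norm (S m n \<omega>) + norm (S m k \<omega>)"
          by (metis add_diff_cancel_left' norm_triangle_ineq4)
        with m[of n] m[of k] that True j show ?thesis
          by simp
      next
        case False
        with \<open>e > 0\<close> show ?thesis
          by (simp add: S_def)
      qed
      then show "\<exists>N. \<forall>m\<ge>N. \<forall>n. norm (S m n \<omega>) < e"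
        by blast
    qed
  qed
qed

end

section \<open>The characteristic function as a limit of products over primes\<close>

locale random_euler_product = prob_space M for M :: "'a measure" +
  fixes z :: "nat \<Rightarrow> 'a \<Rightarrow> complex" and s :: real
  assumes indep: "indep_vars (\<lambda>_. borel) z {p. prime p}"
    and distr_z: "\<And>p. prime p \<Longrightarrow> distr M borel (z p) = uniform_circle"
    and s: "s > 1 / 2"
begin

lemma measurable_z [measurable]: "prime p \<Longrightarrow> z p \<in> borel_measurable M"
  using indep by (auto simp: indep_vars_def)

lemma AE_norm_z:
  assumes "prime p"
  shows "AE \<omega> in M. norm (z p \<omega>) = 1"
proof -
  have "AE w in distr M borel (z p). norm w = 1"
    unfolding distr_z[OF assms] by (rule AE_uniform_circle)
  then show ?thesis
    using assms by (subst (asm) AE_distr_iff) auto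
qed

lemma expectation_z:
  assumes "prime p"
  shows "expectation (z p) = 0"
proof -
  have "expectation (z p) = (CLINT w|distr M borel (z p). w)"
    using assms by (simp add: integral_distr)
  then show ?thesis
    using assms uniform_circle_moment[of 1 0] by (simp add: distr_z)
qed

text \<open>The minus sign of the series is left out here and sits in the exponent of
  \<open>local_char\<close> instead.\<close>

definition log_factor :: "nat \<Rightarrow> 'a \<Rightarrow> complex" where
  "log_factor p \<omega> = Ln (1 - of_real (real p powr - s) * z p \<omega>)"

lemma prime_powr_less: 
  assumes "prime p"
  shows "real p powr - s \<le> 2 powr - s" "real p powr - s < 1"
proof -
  have "real p \<ge> 2"
    using prime_ge_2_nat[OF assms] by simp
  then show "real p powr - s \<le> 2 powr - s"
    using s by (intro powr_mono2') auto
  also have "2 powr - s < 1"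
    using s by (simp add: powr_less_one)
  finally show "real p powr - s < 1" .
qed

text \<open>To first order the logarithm is \<open>- X p\<close>, whose series converges almost
  surely because the squares \<open>p powr (- 2 * s)\<close> are summable for
  \<open>s > 1 / 2\<close>. The remainder is quadratic in \<open>a p\<close>, hence absolutely
  summable.\<close>

lemma AE_summable_log_factor: "AE \<omega> in M. summable (\<lambda>p. if prime p then log_factor p \<omega> else 0)"
proof -
  define a where "a = (\<lambda>p::nat. real p powr - s)"
  define X where "X = (\<lambda>p \<omega>. of_real (a p) * z p \<omega>)"
  have a2: "a p ^ 2 = real p powr (- 2 * s)" for p
    by (simp add: a_def power2_eq_square flip: powr_add)
  have sm2: "summable (\<lambda>p. a p ^ 2)"
    unfolding a2 using s by (subst summable_real_powr_iff) auto
  have "AE \<omega> in M. summable (\<lambda>p. if p \<in> {p. prime p} then X p \<omega> else 0)"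
  proof (rule AE_summable_indep)
    show "indep_vars (\<lambda>_. borel) X {p. prime p}"
      unfolding X_def by (rule indep_vars_compose2[OF indep]) auto
    show "AE \<omega> in M. norm (X p \<omega>) = a p" if "p \<in> {p. prime p}" for p
      using AE_norm_z[of p] that by (auto simp: X_def norm_mult a_def elim!: eventually_mono)
    show "expectation (X p) = 0" if "p \<in> {p. prime p}" for p
      using that by (simp add: X_def expectation_z)
    show "summable (\<lambda>i. if i \<in> {p. prime p} then a i ^ 2 else 0)"
      by (rule summable_comparison_test[OF _ sm2]) auto
  qed
  moreover have "AE \<omega> in M. \<forall>p\<in>{p. prime p}. norm (z p \<omega>) = 1"
    by (subst AE_ball_countable) (auto intro: AE_norm_z)
  ultimately show ?thesis
  proof eventually_elim
    case (elim \<omega>)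
    \<comment> \<open>As primes are at least 2, this bounds \<open>1 / (1 - a p)\<close>
      uniformly.\<close>
    define K where "K = 1 / (1 - 2 powr - s)"
    have "summable (\<lambda>p. K * a p ^ 2)"
      by (intro summable_mult sm2)
    then have "summable (\<lambda>p. if prime p then log_factor p \<omega> + X p \<omega> else 0)"
    proof (rule summable_comparison_test[rotated], intro exI allI impI)
      fix p :: nat
      show "norm (if prime p then log_factor p \<omega> + X p \<omega> else 0) \<le> K * a p ^ 2"
      proof (cases "prime p")
        case True
        then have n: "norm (- X p \<omega>) = a p"
          using elim by (simp add: X_def norm_mult a_def)
        have p: "a p \<le> 2 powr - s" "a p < 1"
          using prime_powr_less[OF True] by (auto simp: a_def)
        have "norm (Ln (1 + - X p \<omega>) - - X p \<omega>) \<le> norm (- X p \<omega>) ^ 2 / (1 - norm (- X p \<omega>))"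
          using p by (intro Ln_approx_linear) (simp add: n del: norm_minus_cancel)
        then have "norm (log_factor p \<omega> + X p \<omega>) \<le> a p ^ 2 / (1 - a p)"
          unfolding n by (simp add: log_factor_def X_def a_def)
        also have "\<dots> \<le> a p ^ 2 / (1 - 2 powr - s)"
          using p s by (intro divide_left_mono mult_pos_pos) (auto simp: powr_less_one)
        finally show ?thesis
          using True by (simp add: K_def)
      next
        case False
        then show ?thesis
          using s by (simp add: K_def powr_less_one less_imp_le)
      qed
    qed
    from summable_diff[OF this elim(1)] show ?case
      by (rule summable_cong[THEN iffD1, rotated]) auto
  qed
qed

definition local_char :: "real \<Rightarrow> nat \<Rightarrow> complex" where
  "local_char x p = (CLINT w|uniform_circle. exp (- (\<i> * of_real x * of_real (Im (Ln (1 - of_real (real p powr - s) * w))))))"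

lemma measurable_log_factor [measurable]: "prime p \<Longrightarrow> log_factor p \<in> borel_measurable M"
proof -
  note [measurable] = borel_measurable_Ln
  assume [simp]: "prime p"
  show ?thesis
    unfolding log_factor_def by measurable
qed

lemma norm_local_char_le_1: "norm (local_char x p) \<le> 1"
proof -
  interpret U: prob_space uniform_circle
    by (rule prob_space_uniform_circle)
  have "norm (local_char x p) \<le> (LINT w|uniform_circle. norm (exp (- (\<i> * of_real x * of_real (Im (Ln (1 - of_real (real p powr - s) * w)))))))"
    unfolding local_char_def by (rule integral_norm_bound)
  then show ?thesis
    by (simp add: U.prob_space)
qed

text \<open>Independence factors the expectation over finitely many primes. The partial sums of
  logarithms converge almost surely and the exponentials have modulus 1, so dominated convergence
  passes to the limit.\<close>

lemma psi_limit: "(\<lambda>n. \<Prod>p | prime p \<and> p < n. local_char x p) \<longlonglongrightarrow> psi M z s x"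
proof -
  define g where "g = (\<lambda>p \<omega>. exp (- (\<i> * of_real x * of_real (Im (log_factor p \<omega>)))))"
  have [measurable]: "g p \<in> borel_measurable M" if "prime p" for p
    unfolding g_def using that by measurable
  have fin: "finite {p. prime p \<and> p < n}" for n :: nat
    by (rule finite_subset[of _ "{..<n}"]) auto
  have prod: "(CLINT \<omega>|M. (\<Prod>p | prime p \<and> p < n. g p \<omega>)) = (\<Prod>p | prime p \<and> p < n. local_char x p)" for n
  proof -
    have ind: "indep_vars (\<lambda>_. borel) g {p. prime p \<and> p < n}"
      unfolding g_def log_factor_def
      by (rule indep_vars_compose2[OF indep_vars_subset[OF indep]]) auto
    have "(CLINT \<omega>|M. (\<Prod>p | prime p \<and> p < n. g p \<omega>)) = (\<Prod>p | prime p \<and> p < n. CLINT \<omega>|M. g p \<omega>)"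
    proof (rule indep_vars_lebesgue_integral[OF fin ind])
      fix p assume "p \<in> {p. prime p \<and> p < n}"
      then show "integrable M (g p)"
        by (intro integrable_const_bound[where B = 1]) (auto simp: g_def)
    qed
    also have "\<dots> = (\<Prod>p | prime p \<and> p < n. local_char x p)"
    proof (rule prod.cong[OF refl])
      fix p assume "p \<in> {p. prime p \<and> p < n}"
      then have p: "prime p" by simp
      then show "(CLINT \<omega>|M. g p \<omega>) = local_char x p"
        unfolding local_char_def distr_z[OF p, symmetric]
        by (subst integral_distr) (auto simp: g_def log_factor_def)
    qed
    finally show ?thesis .
  qed
  have "(\<lambda>n. CLINT \<omega>|M. (\<Prod>p | prime p \<and> p < n. g p \<omega>)) \<longlonglongrightarrow> psi M z s x"
    unfolding psi_def
  proof (rule integral_dominated_convergence[where w = "\<lambda>_. 1"])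
    show "(\<lambda>\<omega>. exp (\<i> * of_real x * of_real (Im (log_euler_product s z \<omega>)))) \<in> borel_measurable M"
    proof -
      note [measurable] = log_euler_product_measurable[of z M s, OF measurable_z]
      show ?thesis by measurable
    qed
    show "(\<lambda>\<omega>. \<Prod>p | prime p \<and> p < n. g p \<omega>) \<in> borel_measurable M" for n
      by (rule borel_measurable_prod) simp
    show "AE \<omega> in M. norm (\<Prod>p | prime p \<and> p < n. g p \<omega>) \<le> 1" for n
      by (simp add: g_def prod_norm[symmetric])
    show "AE \<omega> in M. (\<lambda>n. \<Prod>p | prime p \<and> p < n. g p \<omega>)
        \<longlonglongrightarrow> exp (\<i> * of_real x * of_real (Im (log_euler_product s z \<omega>)))"
      using AE_summable_log_factor
    proof eventually_elim
      case (elim \<omega>)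
      define u where "u = (\<lambda>p. if prime p then log_factor p \<omega> else 0)"
      have "(\<lambda>n. \<Sum>p<n. u p) \<longlonglongrightarrow> suminf u"
        using elim unfolding u_def by (rule summable_LIMSEQ)
      then have "(\<lambda>n. exp (\<i> * of_real x * of_real (Im (- (\<Sum>p<n. u p)))))
          \<longlonglongrightarrow> exp (\<i> * of_real x * of_real (Im (- suminf u)))"
        by (intro tendsto_intros)
      also have "- suminf u = log_euler_product s z \<omega>"
        by (simp add: log_euler_product_def u_def log_factor_def cong: if_cong)
      also have "(\<lambda>n. exp (\<i> * of_real x * of_real (Im (- (\<Sum>p<n. u p))))) = (\<lambda>n. \<Prod>p | prime p \<and> p < n. g p \<omega>)"
      proof
        fix n
        have "(\<Sum>p<n. u p) = (\<Sum>p\<in>{p\<in>{..<n}. prime p}. log_factor p \<omega>)"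
          unfolding u_def by (subst sum.inter_filter) auto
        also have "{p\<in>{..<n}. prime p} = {p. prime p \<and> p < n}"
          by auto
        finally have "(\<Sum>p<n. u p) = (\<Sum>p | prime p \<and> p < n. log_factor p \<omega>)" .
        then have "\<i> * of_real x * of_real (Im (- (\<Sum>p<n. u p)))
            = (\<Sum>p | prime p \<and> p < n. - (\<i> * of_real x * of_real (Im (log_factor p \<omega>))))"
          by (simp add: sum_distrib_left sum_negf)
        then show "exp (\<i> * of_real x * of_real (Im (- (\<Sum>p<n. u p)))) = (\<Prod>p | prime p \<and> p < n. g p \<omega>)"
          unfolding g_def by (simp only: exp_sum[OF fin])
      qed
      finally show ?case .
    qed
  qed simp
  then show ?thesis
    unfolding prod .
qed

text \<open>Local factors have modulus at most 1, so those outside \<open>P\<close> may be dropped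
  before passing to the limit.\<close>

lemma norm_psi_le_prod:
  assumes "finite P" "P \<subseteq> {p. prime p}"
  shows "norm (psi M z s x) \<le> (\<Prod>p\<in>P. norm (local_char x p))"
proof (rule LIMSEQ_le_const2)
  show "(\<lambda>n. norm (\<Prod>p | prime p \<and> p < n. local_char x p)) \<longlonglongrightarrow> norm (psi M z s x)"
    by (intro tendsto_norm psi_limit)
  obtain N where N: "\<And>p. p \<in> P \<Longrightarrow> p < N"
    using finite_nat_set_iff_bounded[THEN iffD1, OF assms(1)] by blast
  show "\<exists>N. \<forall>n\<ge>N. norm (\<Prod>p | prime p \<and> p < n. local_char x p) \<le> (\<Prod>p\<in>P. norm (local_char x p))"
  proof (intro exI allI impI)
    fix n assume "N \<le> n"
    then have sub: "P \<subseteq> {p. prime p \<and> p < n}"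
      using N assms(2) order.strict_trans2 by blast
    have fin: "finite {p. prime p \<and> p < n}"
      by (rule finite_subset[of _ "{..<n}"]) auto
    have "norm (\<Prod>p | prime p \<and> p < n. local_char x p)
        = (\<Prod>p\<in>{p. prime p \<and> p < n} - P. norm (local_char x p)) * (\<Prod>p\<in>P. norm (local_char x p))"
      by (simp add: prod_norm norm_mult prod.subset_diff[OF sub fin])
    also have "\<dots> \<le> 1 * (\<Prod>p\<in>P. norm (local_char x p))"
      by (intro mult_right_mono prod_nonneg prod_le_1) (auto simp: norm_local_char_le_1)
    finally show "norm (\<Prod>p | prime p \<and> p < n. local_char x p) \<le> (\<Prod>p\<in>P. norm (local_char x p))"
      by simp
  qed
qed

lemma norm_psi_le_exp_sum:
  assumes "x \<ge> 64" "finite P" "P \<subseteq> {p. prime p}"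
  shows "norm (psi M z s x) \<le> exp (- (\<Sum>p\<in>P. min ((x * real p powr - s)\<^sup>2 / 4) (ln 2)))"
proof -
  \<comment> \<open>The threshold 64 comes from \<open>64^2 = 4096 >= 4000\<close>.\<close>
  have d: "4 / x\<^sup>2 \<le> 1 / 1000"
    using assms(1) power_mono[of 64 x 2] by (simp add: divide_simps)
  have "norm (local_char x p) \<le> exp (- min ((x * real p powr - s)\<^sup>2 / 4) (ln 2))" if "p \<in> P" for p
  proof -
    have p: "prime p" using that assms by auto
    let ?r = "real p powr - s"
    have r: "0 \<le> ?r" "?r < 1"
      using prime_powr_less[OF p] by auto
    then have "x\<^sup>2 * ?r\<^sup>2 / 4 < 1 / (4 / x\<^sup>2)"
      using assms power_strict_mono[of ?r 1 2] by simp
    then have "\<bar>bessel_like (4 / x\<^sup>2) (x\<^sup>2 * ?r\<^sup>2 / 4)\<bar> \<le> exp (- min (x\<^sup>2 * ?r\<^sup>2 / 4) (ln 2))"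
      using assms d by (intro abs_bessel_like_le) auto
    moreover have "local_char x p = of_real (bessel_like (4 / x\<^sup>2) (x\<^sup>2 * ?r\<^sup>2 / 4))"
      unfolding local_char_def using assms r by (intro integral_uniform_circle_eq_bessel_like) auto
    ultimately show ?thesis
      by (simp add: power_mult_distrib)
  qed
  then have "(\<Prod>p\<in>P. norm (local_char x p)) \<le> (\<Prod>p\<in>P. exp (- min ((x * real p powr - s)\<^sup>2 / 4) (ln 2)))"
    by (intro prod_mono) auto
  also have "\<dots> = exp (- (\<Sum>p\<in>P. min ((x * real p powr - s)\<^sup>2 / 4) (ln 2)))"
    by (simp add: exp_sum[OF assms(2), symmetric] sum_negf)
  finally show ?thesis
    using norm_psi_le_prod[OF assms(2,3), of x] by linarith
qed

end

section \<open>Summation over the primes\<close>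

text \<open>Layer-cake summation: each \<open>p\<close> is counted for \<open>v\<close> from
  \<open>l\<close> up to \<open>min (w p) g\<close>, an interval of length at most
  \<open>min (w p) g\<close>. A positive \<open>l\<close> keeps a singularity of \<open>h\<close> at
  0 out of range.\<close>

lemma integral_card_le_sum_min:
  fixes w :: "'i \<Rightarrow> real"
  assumes P: "finite P" and l: "0 \<le> l" and w: "\<And>p. p \<in> P \<Longrightarrow> 0 \<le> w p" and g: "0 \<le> g"
    and h: "(h has_integral J) {l..g}"
    and le: "\<And>v. v \<in> {l..g} \<Longrightarrow> h v \<le> real (card {p \<in> P. v \<le> w p})"
  shows "J \<le> (\<Sum>p\<in>P. min (w p) g)"
proof -
  define c where "c = (\<lambda>p. measure lborel {l..min (w p) g})"
  have "((\<lambda>v. if v \<le> w p then 1 else 0) has_integral c p) {l..g}" for p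
  proof -
    have "((\<lambda>v. if v \<in> {l..min (w p) g} then 1 else 0) has_integral c p) {l..g}"
      using has_integral_const_real[of "1::real" l "min (w p) g"]
      by (subst has_integral_restrict) (auto simp: c_def)
    then show ?thesis
      by (rule has_integral_eq[rotated]) auto
  qed
  then have "((\<lambda>v. \<Sum>p\<in>P. if v \<le> w p then 1 else 0) has_integral (\<Sum>p\<in>P. c p)) {l..g}"
    by (intro has_integral_sum P)
  moreover have "(\<Sum>p\<in>P. if v \<le> w p then 1 else 0) = real (card {p \<in> P. v \<le> w p})" for v
    using P by (simp add: sum.If_cases Int_def)
  ultimately have "J \<le> (\<Sum>p\<in>P. c p)"
    using le by (intro has_integral_le[OF h]) auto
  also have "\<dots> \<le> (\<Sum>p\<in>P. min (w p) g)"
    using l w g by (intro sum_mono) (auto simp: c_def content_real_if)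
  finally show ?thesis .
qed

section \<open>The numerical constant\<close>

lemma exp_1_mult_le_exp: "exp 1 * u \<le> exp (u :: real)"
proof -
  have "exp 1 * (1 + (u - 1)) \<le> exp 1 * exp (u - 1)"
    by (intro mult_left_mono exp_ge_add_one_self) auto
  then show ?thesis
    by (simp flip: exp_add)
qed

text \<open>The value 0.69 serves as the constant in the prime count; the sharper
  \<open>307 / 443\<close> (about 0.6930) is for the logarithm of \<open>4 * ln 2\<close>.\<close>

lemma ln2_bounds: "69 / 100 < ln (2 :: real)" "307 / 443 \<le> ln (2 :: real)" "ln (2 :: real) < 1"
  using ln_approx_bounds[of 2 3] ln2_le_25_over_36 by (simp_all add: eval_nat_numeral)

text \<open>With \<open>a = 4 * ln 2\<close>, the tangent bound gives
  \<open>a powr b = exp (b * ln a) >= e * b * ln a\<close>. Since \<open>a\<close> is close to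
  \<open>e\<close>, the inequality \<open>ln u <= u - 1\<close> at \<open>u = e / a\<close> yields
  \<open>ln a >= 1.019\<close>, and \<open>2.718 * 1.019 > 4 * 0.69\<close>.\<close>

lemma powr_4_ln2_div_ge:
  assumes "0 < b"
  shows "(4 * ln 2) powr b / (4 * b) \<ge> 69 / (100 :: real)"
proof -
  define a :: real where "a = 4 * ln 2"
  have a: "a \<ge> 1228 / 443" "a > 0"
    using ln2_bounds by (simp_all add: a_def)
  have e: "exp 1 < (2719 / 1000 :: real)" "exp 1 > (2718 / 1000 :: real)"
    using e_approx_32 by (simp_all add: abs_if split: if_split_asm)
  have "exp 1 / a \<le> (2719 / 1000) / (1228 / 443)"
    using a e by (intro frac_le) auto
  also have "\<dots> \<le> 981 / 1000"
    by simp
  finally have "exp 1 / a \<le> 981 / 1000" .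
  moreover have "ln (exp 1 / a) \<le> exp 1 / a - 1"
    using a by (intro ln_le_minus_one) auto
  moreover have "ln (exp 1 / a) = 1 - ln a"
    using a by (simp add: ln_div)
  ultimately have ln_a: "ln a \<ge> 1019 / 1000"
    by linarith
  have "exp 1 * ln a * b \<le> a powr b"
    using exp_1_mult_le_exp[of "b * ln a"] a by (simp add: powr_def mult_ac)
  moreover have "2718 / 1000 * (1019 / 1000) \<le> exp 1 * ln a"
    using e ln_a by (intro mult_mono) auto
  then have "2718 / 1000 * (1019 / 1000) * b \<le> exp 1 * ln a * b"
    using assms by (intro mult_right_mono) auto
  ultimately have "69 / 100 * (4 * b) \<le> a powr b"
    using assms by linarith
  then show ?thesis
    using assms unfolding a_def[symmetric] by (simp add: divide_simps)
qed

lemma has_integral_powr_4: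
  fixes b :: real
  assumes "0 < v0" "v0 \<le> g" "b < 1"
  shows "((\<lambda>v. (4 * v) powr - b) has_integral
    ((4 * g) powr (1 - b) / (4 * (1 - b)) - (4 * v0) powr (1 - b) / (4 * (1 - b)))) {v0..g}"
proof (rule fundamental_theorem_of_calculus)
  fix v assume v: "v \<in> {v0..g}"
  define c where "c = 1 - b"
  have "c \<noteq> 0" "- b = c - 1"
    using assms by (auto simp: c_def)
  then have "((\<lambda>v. (4 * v) powr (1 - b) / (4 * (1 - b))) has_real_derivative (4 * v) powr - b) (at v within {v0..g})"
    unfolding c_def[symmetric] using v assms by (auto intro!: derivative_eq_intros)
  then show "((\<lambda>v. (4 * v) powr (1 - b) / (4 * (1 - b))) has_vector_derivative (4 * v) powr - b) (at v within {v0..g})"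
    by (simp add: has_real_derivative_iff_has_vector_derivative)
qed (use assms in auto)

lemma eventually_sum_primes_ge:
  fixes s :: real
  assumes s: "s > 1 / 2"
  shows "\<forall>\<^sub>F x in at_top. \<exists>P. finite P \<and> P \<subseteq> {p. prime p} \<and>
    0.47 * x powr (1 / s) / ln (x powr (1 / s)) \<le> (\<Sum>p\<in>P. min ((x * real p powr - s)\<^sup>2 / 4) (ln 2))"
proof -
  define b where "b = 1 / (2 * s)"
  have b: "0 < b" "b < 1"
    using s by (auto simp: b_def field_simps)
  \<comment> \<open>The integrand has a singularity at 0; the part cut off below \<open>v0\<close> has mass \<open>5/1000\<close>.\<close>
  define v0 where "v0 = (2 / 100 * (1 - b)) powr (1 / (1 - b)) / 4"
  have v0: "0 < v0" "4 * v0 \<le> 1" "v0 \<le> ln 2"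
  proof -
    show "0 < v0"
      using b by (simp add: v0_def)
    show "4 * v0 \<le> 1"
      using b by (auto simp: v0_def intro: powr_le1)
    then show "v0 \<le> ln 2"
      using ln2_bounds by simp
  qed
  have v0_powr: "(4 * v0) powr (1 - b) = 2 / 100 * (1 - b)"
    using b by (simp add: v0_def powr_powr)
  define J where "J = (4 * ln 2) powr (1 - b) / (4 * (1 - b)) - (4 * v0) powr (1 - b) / (4 * (1 - b))"
  have int: "((\<lambda>v. (4 * v) powr - b) has_integral J) {v0..ln 2}"
    unfolding J_def using v0 b by (intro has_integral_powr_4) auto
  have J: "J \<ge> 685 / 1000"
  proof -
    have "2 / 100 * (1 - b) / (4 * (1 - b)) = 5 / 1000"
      using b by (simp add: divide_simps)
    moreover have "69 / 100 \<le> (4 * ln 2) powr (1 - b) / (4 * (1 - b))"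
      using b by (intro powr_4_ln2_div_ge) auto
    ultimately show ?thesis
      unfolding J_def v0_powr by linarith
  qed
  \<comment> \<open>The excess of \<open>ln (t v0)\<close> over \<open>ln y\<close>, where
    \<open>t v0\<close> is the largest cutoff for the primes.\<close>
  define L where "L = - b * ln (4 * v0)"
  have L: "L \<ge> 0"
    using b v0 by (simp add: L_def mult_nonneg_nonpos)
  obtain t0 where t0: "\<And>t. t \<ge> t0 \<Longrightarrow> 69 / 100 * t / ln t \<le> real (card {p. prime p \<and> real p \<le> t})"
    using eventually_card_primes_ge[OF ln2_bounds(1)] unfolding eventually_at_top_linorder by blast
  have lim: "filterlim (\<lambda>x. x powr (1 / s)) at_top at_top"
    using s by real_asymp
  \<comment> \<open>Every cutoff \<open>t v\<close> used below is at least \<open>y / 4\<close>, so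
    this makes it at least \<open>t0\<close> and 2.\<close>
  have ev: "\<forall>\<^sub>F x in at_top. x powr (1 / s) \<ge> 4 * max t0 2"
    using lim unfolding filterlim_at_top by blast
  \<comment> \<open>Makes \<open>L\<close> at most \<open>ln y / 200\<close>, a loss that the margin
    in the constants can bear.\<close>
  have ev2: "\<forall>\<^sub>F x in at_top. x powr (1 / s) \<ge> exp (200 * L + 1)"
    using lim unfolding filterlim_at_top by blast
  show ?thesis
    using ev ev2 eventually_gt_at_top[of 0]
  proof eventually_elim
    case (elim x)
    define y where "y = x powr (1 / s)"
    have y: "y \<ge> 4 * t0" "y \<ge> 8" and lny: "ln y \<ge> 200 * L + 1"
      using elim ln_ge_iff[of y "200 * L + 1"] by (auto simp: y_def)
    define t where "t = (\<lambda>v. y * (4 * v) powr - b)"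
    define P where "P = {p. prime p \<and> real p \<le> t v0}"
    have P: "finite P"
      by (rule finite_subset[of _ "{..nat \<lceil>t v0\<rceil>}"]) (auto simp: P_def, linarith)
    have t_mono: "t v \<le> t v0" if "v \<in> {v0..ln 2}" for v
      unfolding t_def using that v0 b y by (intro mult_left_mono powr_mono2') auto
    have t_ge: "t v \<ge> y / 4" if "v \<in> {v0..ln 2}" for v
    proof -
      have "1 / 4 = 4 powr (- 1 :: real)"
        by (simp add: powr_minus_divide)
      also have "\<dots> \<le> 4 powr - b"
        using b by (intro powr_mono) auto
      also have "\<dots> \<le> (4 * v) powr - b"
        using that v0 b ln2_bounds(3) by (intro powr_mono2') auto
      finally have "y * (1 / 4) \<le> y * (4 * v) powr - b"
        using y by (intro mult_left_mono) auto
      then show ?thesis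
        by (simp add: t_def)
    qed
    have ln_t0: "ln (t v0) = ln y + L"
      unfolding t_def L_def using y v0 by (simp add: ln_mult ln_powr)
    \<comment> \<open>Replacing \<open>ln (t v)\<close> by the larger \<open>ln (t v0)\<close> makes
      the denominator independent of \<open>v\<close>, so that only a power of \<open>v\<close> has
      to be integrated.\<close>
    have card: "69 / 100 * y / (ln y + L) * (4 * v) powr - b
        \<le> real (card {p \<in> P. v \<le> (x * real p powr - s)\<^sup>2 / 4})" if v: "v \<in> {v0..ln 2}" for v
    proof -
      have t: "t v \<ge> t0" "t v \<ge> 2"
        using t_ge[OF v] y by auto
      have "69 / 100 * y / (ln y + L) * (4 * v) powr - b = 69 / 100 * t v / ln (t v0)"
        unfolding ln_t0 by (simp add: t_def)
      also have "\<dots> \<le> 69 / 100 * t v / ln (t v)"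
        using t t_mono[OF v] by (intro divide_left_mono mult_pos_pos) auto
      also have "\<dots> \<le> real (card {p. prime p \<and> real p \<le> t v})"
        by (rule t0[OF t(1)])
      also have "\<dots> \<le> real (card {p \<in> P. v \<le> (x * real p powr - s)\<^sup>2 / 4})"
      proof (intro of_nat_mono card_mono subsetI)
        fix p assume "p \<in> {p. prime p \<and> real p \<le> t v}"
        then have p: "prime p" "real p \<le> t v"
          by auto
        have p0: "real p > 0"
          using prime_gt_0_nat[OF p(1)] by simp
        have vpos: "v > 0"
          using v v0 by auto
        \<comment> \<open>Raising to the power \<open>- 2 * s\<close> turns the cutoff
          \<open>p <= t v\<close> into the condition
          \<open>v <= (x * p powr (- s))^2 / 4\<close>.\<close>
        have "t v powr - (2 * s) \<le> real p powr - (2 * s)"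
          using p p0 s by (intro powr_mono2') auto
        moreover have "t v powr - (2 * s) = 4 * v / x\<^sup>2"
        proof -
          have "y powr - (2 * s) = x powr - 2"
            unfolding y_def powr_powr using s by (simp add: field_simps)
          moreover have "((4 * v) powr - b) powr - (2 * s) = 4 * v"
            unfolding powr_powr b_def using s vpos by simp
          moreover have "t v powr - (2 * s) = y powr - (2 * s) * ((4 * v) powr - b) powr - (2 * s)"
            unfolding t_def using y by (subst powr_mult) auto
          moreover have "x powr - 2 = 1 / x\<^sup>2"
            using elim by (simp add: powr_minus_divide)
          ultimately show ?thesis
            by simp
        qed
        moreover have "real p powr - (2 * s) = (real p powr - s)\<^sup>2"
          by (simp add: power2_eq_square flip: powr_add)
        ultimately have "4 * v / x\<^sup>2 \<le> (real p powr - s)\<^sup>2"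
          by simp
        then have "v \<le> (x * real p powr - s)\<^sup>2 / 4"
          using elim by (simp add: divide_simps power_mult_distrib mult.commute)
        then show "p \<in> {p \<in> P. v \<le> (x * real p powr - s)\<^sup>2 / 4}"
          using p t_mono[OF v] by (simp add: P_def)
      qed (use P in auto)
      finally show ?thesis .
    qed
    have "69 / 100 * y / (ln y + L) * J \<le> (\<Sum>p\<in>P. min ((x * real p powr - s)\<^sup>2 / 4) (ln 2))"
    proof (rule integral_card_le_sum_min[OF P _ _ _ has_integral_mult_right[OF int]])
      show "69 / 100 * y / (ln y + L) * (4 * v) powr - b
          \<le> real (card {p \<in> P. v \<le> (x * real p powr - s)\<^sup>2 / 4})" if "v \<in> {v0..ln 2}" for v
        by (rule card[OF that])
    qed (use v0 in auto)
    moreover have "0.47 * y / ln y \<le> 69 / 100 * y / (ln y + L) * J"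
    proof -
      \<comment> \<open>The margin: \<open>0.69 * 0.685 = 0.47265\<close>, while
        \<open>0.47 * (1 + 1 / 200) = 0.47235\<close>.\<close>
      have "47 / 100 * (ln y + L) \<le> 69 / 100 * (685 / 1000) * ln y"
        using lny L by simp
      also have "\<dots> \<le> 69 / 100 * J * ln y"
        using J lny L by (intro mult_right_mono mult_left_mono) auto
      finally have "y * (47 / 100 * (ln y + L)) \<le> y * (69 / 100 * J * ln y)"
        using y by (intro mult_left_mono) auto
      then show ?thesis
        using lny L by (simp add: divide_simps mult_ac)
    qed
    ultimately show ?case
      using P by (intro exI[of _ P]) (auto simp: P_def y_def)
  qed
qed

section \<open>Combining the product bound with the sum over primes\<close>

theorem theorem4:
  fixes M :: "'a measure" and z :: "nat \<Rightarrow> 'a \<Rightarrow> complex" and \<sigma> :: real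
  assumes "prob_space M"
    and "prob_space.indep_vars M (\<lambda>_. borel) z {p. prime p}"
    and "\<And>p. prime p \<Longrightarrow> distr M borel (z p) = uniform_circle"
    and "\<sigma> > 1 / 2"
  shows "(\<forall>x. cmod (psi M z \<sigma> x) \<le> 1) \<and>
    (\<exists>c\<ge>0.47. \<exists>x0. \<forall>x\<ge>x0. cmod (psi M z \<sigma> x)
        \<le> exp (- (c * x powr (1 / \<sigma>) / ln (x powr (1 / \<sigma>)))))"
proof -
  interpret random_euler_product M z \<sigma>
    by (intro random_euler_product.intro random_euler_product_axioms.intro assms)
  \<comment> \<open>The empty set of primes gives the empty product 1.\<close>
  have "\<forall>x. cmod (psi M z \<sigma> x) \<le> 1"
    using norm_psi_le_prod[of "{}"] by simp
  moreover have "\<forall>\<^sub>F x in at_top. cmod (psi M z \<sigma> x)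
      \<le> exp (- (0.47 * x powr (1 / \<sigma>) / ln (x powr (1 / \<sigma>))))"
    using eventually_sum_primes_ge[OF assms(4)] eventually_ge_at_top[of 64]
  proof eventually_elim
    case (elim x)
    then obtain P where P: "finite P" "P \<subseteq> {p. prime p}"
      and ge: "0.47 * x powr (1 / \<sigma>) / ln (x powr (1 / \<sigma>))
        \<le> (\<Sum>p\<in>P. min ((x * real p powr - \<sigma>)\<^sup>2 / 4) (ln 2))"
      by blast
    have "cmod (psi M z \<sigma> x) \<le> exp (- (\<Sum>p\<in>P. min ((x * real p powr - \<sigma>)\<^sup>2 / 4) (ln 2)))"
      by (rule norm_psi_le_exp_sum[OF elim(2) P])
    also have "\<dots> \<le> exp (- (0.47 * x powr (1 / \<sigma>) / ln (x powr (1 / \<sigma>))))"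
      using ge by simp
    finally show ?case .
  qed
  ultimately show ?thesis
    unfolding eventually_at_top_linorder by blast
qed

end
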